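(* Let $K\ge 2$, $M\ge1$, and let $J_1,\dots,J_K:\mathbb{R}^M\to\mathbb{R}$ be differentiable, convex and $\delta$-smooth. Let $A\in\mathbb{R}^{K\times K}$ be symmetric, doubly stochastic and primitive. Set $\mathcal{B}=(I_K-A)^{1/2}\otimes I_M$, and for $\mathsf{w}=\mathrm{col}\{w_1,\dots,w_K\}\in\mathbb{R}^{KM}$ set $\mathcal{J}(\mathsf{w})=\sum_{k=1}^K J_k(w_k)$ and $\mathcal{J}_\rho(\mathsf{w})=\mathcal{J}(\mathsf{w})+\frac{\rho}{2}\|\mathcal{B}\mathsf{w}\|^2$, $\rho\ge0$. With positive step-sizes $\mu_w,\mu_\lambda$, arbitrary $\mathsf{w}_{-1}\in\mathbb{R}^{KM}$ and $\mathsf{y}_{-1}=0$, consider for $i\ge 0$ $$\mathsf{w}_i=\mathsf{w}_{i-1}-\mu_w\nabla\mathcal{J}_\rho(\mathsf{w}_{i-1})-\mu_w\mathsf{y}_{i-1},\qquad \mathsf{y}_i=\mathsf{y}_{i-1}+\mu_\lambda\mathcal{B}^2\mathsf{w}_i.$$ (i) Suppose $\rho>0$ and the aggregate cost $\frac1K\sum_{k=1}^KJ_k(w)$ is $\bar\beta$-strongly-convex. Let $\delta_\rho=\delta+\rho\,\sigma_{\max}^2(\mathcal{B})$ and, for a fixed $\eta\in\big(0,\frac{\bar\beta}{2\delta}\big)$, $$\nu_\rho=\min\Big\{\bar\beta-2\delta\eta,\ \frac{\rho\,\underline{\sigma}^2(\mathcal{B})\,\eta^2}{4(\eta^2+1)}\Big\}>0.$$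 If $\mu_w<\frac1{\delta_\rho}$ and $\mu_\lambda\le\frac{\nu_\rho}{\sigma_{\max}^2(\mathcal{B})}$, then the recursion converges linearly, with convergence rate upper bounded by $$\gamma_{AL}=\max\big\{1-\mu_w\nu_\rho(1-\mu_w\delta_\rho),\ 1-\mu_w\mu_\lambda\underline{\sigma}^2(\mathcal{B})\big\}.$$ (ii) Suppose $\rho=0$ and each $J_k$ is $\beta_k$-strongly-convex, and let $\nu_0=\min_k\beta_k$. If $\mu_w<\frac1\delta$ and $\mu_\lambda\le\frac{\nu_0}{\sigma_{\max}^2(\mathcal{B})}$, then the recursion converges linearly, with convergence rate upper bounded by $$\gamma_{L}=\max\big\{1-\mu_w\nu_0(1-\mu_w\delta),\ 1-\mu_w\mu_\lambda\underline{\sigma}^2(\mathcal{B})\big\}.$$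
   Context: Norms are Euclidean; $\otimes$ is the Kronecker product; $\mathrm{col}\{\cdot\}$ stacks vectors; $\sigma_{\max}(\cdot)$ and $\underline{\sigma}(\cdot)$ are the largest and the smallest non-zero singular values. $I_K-A$ is positive semidefinite and $(I_K-A)^{1/2}$ is its positive semidefinite square root. $A$ primitive means that all entries of $A^p$ are positive for some integer $p>0$. A differentiable $f$ is $\delta$-smooth ($\delta>0$) if $\|\nabla f(x)-\nabla f(y)\|\le\delta\|x-y\|$ for all $x,y$, and $\nu$-strongly-convex ($\nu>0$) if $(x-y)^{\mathsf T}(\nabla f(x)-\nabla f(y))\ge\nu\|x-y\|^2$ for all $x,y$. Let $w^\star$ be the minimizer of $\frac1K\sum_kJ_k$; then $\mathsf{w}^\star=\mathrm{col}\{w^\star,\dots,w^\star\}$ is the unique solution of $\min\mathcal{J}(\mathsf{w})$ s.t. $\mathcal{B}\mathsf{w}=0$. Let $\lambda_b^\star$ be the unique vector in the range of $\mathcal{B}$ with $\nabla\mathcal{J}(\mathsf{w}^\star)+\mathcal{B}\lambda_b^\star=0$. "The recursion converges linearly with convergence rate upper bounded by $\gamma$" means: $\gamma<1$ and there is a constant $C\ge0$ such that $\|\mathsf{w}_i-\mathsf{w}^\star\|^2+\|\mathsf{y}_i-\mathcal{B}\lambda_b^\star\|^2\le C\gamma^{i}$ for all $i\ge0$. *)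

theory Defs
  imports "HOL-Analysis.Analysis"
begin

text \<open>The library's \<open>^\<close> on type \<open>vec\<close> is componentwise, so matrix powers are
  defined here as iterated matrix products.\<close>

definition mat_power :: "real^'n^'n \<Rightarrow> nat \<Rightarrow> real^'n^'n" where
  "mat_power A p = ((\<lambda>X. A ** X) ^^ p) (mat 1)"

definition doubly_stochastic :: "real^'n^'n \<Rightarrow> bool" where
  "doubly_stochastic A \<longleftrightarrow>
     (\<forall>i j. 0 \<le> A $ i $ j) \<and> (\<forall>i. (\<Sum>j\<in>UNIV. A $ i $ j) = 1) \<and> (\<forall>j. (\<Sum>i\<in>UNIV. A $ i $ j) = 1)"

definition primitive_matrix :: "real^'n^'n \<Rightarrow> bool" where
  "primitive_matrix A \<longleftrightarrow> (\<exists>p>0. \<forall>i j. 0 < mat_power A p $ i $ j)"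

definition pos_semidef :: "real^'n^'n \<Rightarrow> bool" where
  "pos_semidef A \<longleftrightarrow> transpose A = A \<and> (\<forall>x. 0 \<le> x \<bullet> (A *v x))"

definition psd_sqrt :: "real^'n^'n \<Rightarrow> real^'n^'n" where
  "psd_sqrt A = (THE S. pos_semidef S \<and> S ** S = A)"

definition kronecker :: "real^'n^'n \<Rightarrow> real^'m^'m \<Rightarrow> real^('n \<times> 'm)^('n \<times> 'm)" where
  "kronecker A B = (\<chi> p q. A $ fst p $ fst q * B $ snd p $ snd q)"

definition singular_values :: "real^'n^'n \<Rightarrow> real set" where
  "singular_values A = {s. 0 \<le> s \<and> (\<exists>v. v \<noteq> 0 \<and> (transpose A ** A) *v v = s\<^sup>2 *\<^sub>R v)}"

definition sigma_max :: "real^'n^'n \<Rightarrow> real" where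
  "sigma_max A = Max (singular_values A)"

definition sigma_min_nz :: "real^'n^'n \<Rightarrow> real" where
  "sigma_min_nz A = Min {s \<in> singular_values A. s \<noteq> 0}"

lemma finite_singular_values: "finite (singular_values (A :: real^'n^'n))"
proof -
  define T where "T = transpose A ** A"
  define v where "v s = (SOME v. v \<noteq> 0 \<and> T *v v = s\<^sup>2 *\<^sub>R v)" for s
  have v: "v s \<noteq> 0 \<and> T *v v s = s\<^sup>2 *\<^sub>R v s" if "s \<in> singular_values A" for s
  proof -
    have "\<exists>v. v \<noteq> 0 \<and> T *v v = s\<^sup>2 *\<^sub>R v"
      using that by (auto simp: singular_values_def T_def)
    then show ?thesis unfolding v_def by (rule someI_ex)
  qed
  have T_transpose: "transpose T = T" by (simp add: T_def matrix_transpose_mul)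
  have sym: "x \<bullet> (T *v y) = (T *v x) \<bullet> y" for x y
    using dot_lmul_matrix[of x T y] transpose_matrix_vector[of T x] unfolding T_transpose by simp
  have orth: "v s \<bullet> v t = 0"
    if "s \<in> singular_values A" "t \<in> singular_values A" "s \<noteq> t" for s t
  proof -
    have "s\<^sup>2 * (v s \<bullet> v t) = t\<^sup>2 * (v s \<bullet> v t)"
      using sym[of "v s" "v t"] v[OF that(1)] v[OF that(2)] by (metis inner_scaleR_left inner_scaleR_right)
    moreover have "s\<^sup>2 \<noteq> t\<^sup>2"
      using that power2_eq_iff_nonneg[of s t] unfolding singular_values_def by blast
    ultimately show ?thesis by simp
  qed
  have "inj_on v (singular_values A)"
  proof (rule inj_onI, rule ccontr)
    fix s t assume st: "s \<in> singular_values A" "t \<in> singular_values A" "v s = v t" "s \<noteq> t"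
    then have "v s \<bullet> v s = 0" using orth[of s t] by simp
    then show False using v[OF st(1)] by simp
  qed
  moreover have "pairwise orthogonal (v ` singular_values A)"
    unfolding pairwise_def orthogonal_def using orth by blast
  then have "finite (v ` singular_values A)"
    by (rule pairwise_orthogonal_imp_finite)
  ultimately show ?thesis by (rule finite_imageD[rotated])
qed

definition gradient :: "('a::real_inner \<Rightarrow> real) \<Rightarrow> 'a \<Rightarrow> 'a" where
  "gradient f x = (THE D. GDERIV f x :> D)"

lemma gradient_eq:
  assumes "GDERIV f x :> D"
  shows "gradient f x = D"
  unfolding gradient_def
proof (rule the_equality)
  show "GDERIV f x :> D" by fact
next
  fix E assume "GDERIV f x :> E"
  then have "(\<lambda>h. h \<bullet> E) = (\<lambda>h. h \<bullet> D)"
    using assms unfolding gderiv_def by (rule has_derivative_unique)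
  then have "(E - D) \<bullet> E = (E - D) \<bullet> D" by (rule fun_cong)
  then have "(E - D) \<bullet> (E - D) = 0" by (simp add: inner_diff_right)
  then show "E = D" by simp
qed

definition smooth_fun :: "real \<Rightarrow> ('a::real_inner \<Rightarrow> real) \<Rightarrow> bool" where
  "smooth_fun \<delta> f \<longleftrightarrow> 0 < \<delta> \<and> f differentiable_on UNIV \<and>
     (\<forall>x y. norm (gradient f x - gradient f y) \<le> \<delta> * norm (x - y))"

definition strongly_convex_fun :: "real \<Rightarrow> ('a::real_inner \<Rightarrow> real) \<Rightarrow> bool" where
  "strongly_convex_fun \<nu> f \<longleftrightarrow> 0 < \<nu> \<and> f differentiable_on UNIV \<and>
     (\<forall>x y. (x - y) \<bullet> (gradient f x - gradient f y) \<ge> \<nu> * (norm (x - y))\<^sup>2)"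

text \<open>A vector stacking one block in \<open>real^'m\<close> for each \<open>k :: 'k\<close> is an element of
  \<open>real^('k \<times> 'm)\<close>, the index set on which \<open>kronecker\<close> matrices act.\<close>

definition col :: "('k::finite \<Rightarrow> real^'m) \<Rightarrow> real^('k \<times> 'm)" where
  "col w = (\<chi> p. w (fst p) $ snd p)"

definition block :: "real^('k::finite \<times> 'm) \<Rightarrow> 'k \<Rightarrow> real^'m" where
  "block w k = (\<chi> j. w $ (k, j))"

definition network_cost :: "('k::finite \<Rightarrow> real^'m \<Rightarrow> real) \<Rightarrow> real^('k \<times> 'm) \<Rightarrow> real" where
  "network_cost J w = (\<Sum>k\<in>UNIV. J k (block w k))"

definition aggregate_cost :: "('k::finite \<Rightarrow> real^'m \<Rightarrow> real) \<Rightarrow> real^'m \<Rightarrow> real" where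
  "aggregate_cost J w = (1 / real CARD('k)) * (\<Sum>k\<in>UNIV. J k w)"

definition augmented_cost ::
  "('k::finite \<Rightarrow> real^'m \<Rightarrow> real) \<Rightarrow> real^('k \<times> 'm)^('k \<times> 'm) \<Rightarrow> real \<Rightarrow> real^('k \<times> 'm) \<Rightarrow> real" where
  "augmented_cost J B \<rho> w = network_cost J w + \<rho> / 2 * (norm (B *v w))\<^sup>2"

text \<open>The iterates are indexed by \<open>int\<close> because the recursion starts at index \<open>-1\<close>;
  only indices \<open>\<ge> -1\<close> are ever constrained.\<close>

definition converges_linearly ::
  "(int \<Rightarrow> 'a::real_normed_vector) \<Rightarrow> (int \<Rightarrow> 'a) \<Rightarrow> 'a \<Rightarrow> 'a \<Rightarrow> real \<Rightarrow> bool" where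
  "converges_linearly w y w_star y_star \<gamma> \<longleftrightarrow> \<gamma> < 1 \<and>
     (\<exists>C\<ge>0. \<forall>i::nat. (norm (w (int i) - w_star))\<^sup>2 + (norm (y (int i) - y_star))\<^sup>2 \<le> C * \<gamma> ^ i)"

end

theory Submission
  imports Defs
begin

text \<open>Since \<open>y (-1) = 0\<close>, the dual iterate is \<open>y = B \<lambda>\<close> with \<open>\<lambda>\<close> in the range of \<open>B\<close>, where \<open>B\<close> is
  bounded below by its smallest non-zero singular value. For the errors \<open>e\<close> of \<open>w\<close> and \<open>d\<close> of \<open>\<lambda>\<close> the
  function \<open>\<parallel>e\<parallel>\<^sup>2 - \<mu>\<^sub>w \<mu>\<^sub>l \<parallel>B e\<parallel>\<^sup>2 + (\<mu>\<^sub>w / \<mu>\<^sub>l) \<parallel>d\<parallel>\<^sup>2\<close> contracts in every step: the primal part by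
  co-coercivity and strong monotonicity of the gradient towards the solution, the dual part by the
  lower bound on \<open>B\<close>. For \<open>\<rho> > 0\<close> that monotonicity follows by splitting the error into its
  consensus component, controlled by the aggregate cost, and the orthogonal remainder, controlled by
  the penalty.\<close>

section \<open>Spectral theory of symmetric matrices\<close>

text \<open>Several objects of the statement are given by description or selection:
  \<open>psd_sqrt\<close> and \<open>lb_star\<close> by \<open>THE\<close>, the minimizer by
  \<open>ARG_MIN\<close>, the extreme singular values by \<open>Max\<close> and \<open>Min\<close>.
  They say something only once existence, and for \<open>THE\<close> uniqueness, is known; hence the
  eigenbases, the square root and the contraction argument for a zero of the gradient.

  Strong convexity of the aggregate does not make \<open>network_cost J\<close> strongly convex, and
  the penalty is blind along the kernel of \<open>B\<close>. So monotonicity is asked only against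
  the solution: this is a consensus vector, and between two consensus vectors the stacked gradient
  reduces to the aggregate one. The number \<eta> is a threshold for the ratio of remainder to
  consensus component: below it the cross terms cost at most 2 \<delta> \<eta>, above it the penalty
  alone dominates.

  The dual step-size bound keeps the subtracted term of the Lyapunov function at most
  \<open>\<mu>\<^sub>w * \<nu>\<close> times the squared primal error; as \<nu> is at most the
  smoothness constant, the primal bound leaves a positive multiple of that error.\<close>

text \<open>A maximizer of the Rayleigh quotient on the unit sphere of \<open>S\<close> is an
  eigenvector: the form \<open>Q\<close> is non-negative on \<open>S\<close> and vanishes there, and
  a small move along the residual \<open>u\<close> would make it negative unless
  \<open>u = 0\<close>.\<close>

lemma symmetric_eigenvector_exists:
  fixes T :: "'a::euclidean_space \<Rightarrow> 'a"
  assumes lin: "linear T" and sym: "\<And>x y. x \<bullet> T y = T x \<bullet> y"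
    and S: "subspace S" "S \<noteq> {0}" and inv: "\<And>x. x \<in> S \<Longrightarrow> T x \<in> S"
  obtains v l where "v \<in> S" "norm v = 1" "T v = l *\<^sub>R v"
proof -
  let ?K = "S \<inter> sphere 0 1"
  have "compact ?K" using closed_subspace[OF S(1)] by (simp add: closed_Int_compact)
  moreover obtain s where s: "s \<in> S" "s \<noteq> 0" using S subspace_0 by fastforce
  then have "(1 / norm s) *\<^sub>R s \<in> ?K" using S(1) by (simp add: subspace_scale)
  then have "?K \<noteq> {}" by blast
  moreover have "continuous_on ?K (\<lambda>x. x \<bullet> T x)"
    by (intro continuous_intros linear_continuous_on linear_conv_bounded_linear[THEN iffD1] lin)
  ultimately obtain v where v: "v \<in> ?K" and max: "\<And>x. x \<in> ?K \<Longrightarrow> x \<bullet> T x \<le> v \<bullet> T v"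
    using continuous_attains_sup by metis
  define l where "l = v \<bullet> T v"
  define Q where "Q x = l * (x \<bullet> x) - x \<bullet> T x" for x
  have Q_nonneg: "0 \<le> Q x" if "x \<in> S" for x
  proof (cases "x = 0")
    case True
    then show ?thesis using linear_0[OF lin] by (simp add: Q_def)
  next
    case False
    let ?y = "(1 / norm x) *\<^sub>R x"
    have "?y \<in> ?K" using False that S(1) by (simp add: subspace_scale)
    then have "?y \<bullet> T ?y \<le> l" using max l_def by blast
    then have "(x \<bullet> T x) / (norm x * norm x) \<le> l"
      by (simp add: linear_scale[OF lin] divide_simps)
    then show ?thesis using False
      by (simp add: Q_def divide_simps dot_square_norm power2_eq_square split: if_splits)
  qed
  define u where "u = T v - l *\<^sub>R v"
  have uS: "u \<in> S" using v inv S(1) by (simp add: u_def subspace_diff subspace_scale)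
  define a where "a = u \<bullet> u"
  have vv: "v \<bullet> v = 1" using v by (simp add: dot_square_norm)
  have expand: "Q (v + t *\<^sub>R u) = - 2 * t * a + t\<^sup>2 * Q u" for t
  proof -
    have "v \<bullet> T u = u \<bullet> T v" using sym[of v u] by (simp add: inner_commute)
    moreover have "u \<bullet> T v = a + l * (v \<bullet> u)"
      by (simp add: a_def u_def inner_diff_right inner_diff_left inner_commute algebra_simps)
    ultimately show ?thesis using vv unfolding Q_def
      by (simp add: linear_add[OF lin] linear_scale[OF lin] inner_add_left inner_add_right
          inner_commute l_def[symmetric] power2_eq_square algebra_simps)
  qed
  have "a = 0"
  proof (rule ccontr)
    assume "a \<noteq> 0"
    then have a: "a > 0" by (simp add: a_def)
    define q where "q = Q u"
    have q: "q \<ge> 0" using Q_nonneg[OF uS] by (simp add: q_def)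
    \<comment> \<open>Small enough that the linear term of \<open>expand\<close> outweighs the
      quadratic one: \<open>?t * q\<close> is at most \<open>a\<close>. Adding 1 covers
      \<open>q = 0\<close>.\<close>
    let ?t = "a / (q + 1)"
    have "0 \<le> Q (v + ?t *\<^sub>R u)" using v uS S(1) by (intro Q_nonneg subspace_add subspace_scale) auto
    then have "0 \<le> - 2 * ?t * a + ?t\<^sup>2 * q" unfolding expand q_def by simp
    then have "?t * (2 * a) \<le> ?t * (?t * q)" by (simp add: power2_eq_square mult_ac)
    moreover have "0 < ?t" using a q by simp
    ultimately have "2 * a \<le> ?t * q" by (metis mult_le_cancel_left_pos)
    moreover have "?t * q \<le> a" using a q by (simp add: field_simps)
    ultimately show False using a by simp
  qed
  then have "T v = l *\<^sub>R v" by (simp add: a_def u_def)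
  then show thesis using that v by auto
qed

text \<open>Induction on the dimension: one eigenvector is split off, and by symmetry its orthogonal
  complement inside \<open>S\<close> is again invariant. Invariant subspaces keep the induction
  within one type.\<close>

lemma symmetric_eigenbasis_subspace:
  fixes T :: "'a::euclidean_space \<Rightarrow> 'a"
  assumes lin: "linear T" and sym: "\<And>x y. x \<bullet> T y = T x \<bullet> y"
    and S: "subspace S" and inv: "\<And>x. x \<in> S \<Longrightarrow> T x \<in> S"
  shows "\<exists>C. C \<subseteq> S \<and> pairwise orthogonal C \<and> S \<subseteq> span C \<and>
    (\<forall>b\<in>C. norm b = 1 \<and> (\<exists>l. T b = l *\<^sub>R b))"
  using S inv
proof (induction "dim S" arbitrary: S rule: less_induct)
  case less
  show ?case
  proof (cases "S = {0}")
    case True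
    then show ?thesis by (intro exI[of _ "{}"]) auto
  next
    case False
    obtain v l where v: "v \<in> S" "norm v = 1" "T v = l *\<^sub>R v"
      using symmetric_eigenvector_exists[OF lin sym less.prems(1) False less.prems(2)] by metis
    define S' where "S' = {x \<in> S. v \<bullet> x = 0}"
    have sub: "subspace S'" using less.prems(1)
      by (auto simp: S'_def subspace_def inner_add_right)
    have "v \<notin> S'" using v by (auto simp: S'_def)
    moreover have "S' \<subseteq> S" by (auto simp: S'_def)
    ultimately have "S' \<subset> S" using v(1) by blast
    then have "dim S' < dim S"
      using dim_psubset[of S' S] sub[folded span_eq_iff] less.prems(1)[folded span_eq_iff] by simp
    moreover have "T x \<in> S'" if "x \<in> S'" for x
      using that less.prems(2) v(3) sym[of v x] by (simp add: S'_def)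
    ultimately obtain C where C: "C \<subseteq> S'" "pairwise orthogonal C" "S' \<subseteq> span C"
        "\<forall>b\<in>C. norm b = 1 \<and> (\<exists>l. T b = l *\<^sub>R b)"
      using less.hyps sub by metis
    have vv: "v \<bullet> v = 1" using v(2) by (simp add: dot_square_norm)
    have "S \<subseteq> span (insert v C)"
    proof
      fix x assume "x \<in> S"
      then have "x - (v \<bullet> x) *\<^sub>R v \<in> S'"
        using v(1) vv less.prems(1) by (simp add: S'_def subspace_diff subspace_scale inner_diff_right)
      then show "x \<in> span (insert v C)" using C(3) by (auto simp: span_insert)
    qed
    moreover have "pairwise orthogonal (insert v C)"
      using C(1,2) by (auto simp: pairwise_insert orthogonal_def S'_def inner_commute)
    ultimately show ?thesis using C v
      by (intro exI[of _ "insert v C"]) (auto simp: S'_def)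
  qed
qed

lemma symmetric_eigenbasis:
  fixes T :: "'a::euclidean_space \<Rightarrow> 'a"
  assumes lin: "linear T" and sym: "\<And>x y. x \<bullet> T y = T x \<bullet> y"
  obtains C l where "finite C" "\<And>b. b \<in> C \<Longrightarrow> norm b = 1" "pairwise orthogonal C"
    "\<And>b. b \<in> C \<Longrightarrow> T b = l b *\<^sub>R b" "\<And>x. (\<Sum>b\<in>C. (b \<bullet> x) *\<^sub>R b) = x"
proof -
  obtain C where C: "pairwise orthogonal C" "UNIV \<subseteq> span C"
      "\<forall>b\<in>C. norm b = 1 \<and> (\<exists>l. T b = l *\<^sub>R b)"
    using symmetric_eigenbasis_subspace[OF lin sym subspace_UNIV] by auto
  then obtain l where l: "\<And>b. b \<in> C \<Longrightarrow> T b = l b *\<^sub>R b" by metis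
  have fin: "finite C" by (rule pairwise_orthogonal_imp_finite[OF C(1)])
  show thesis
  proof (rule that[OF fin _ C(1) l])
    fix x
    show "(\<Sum>b\<in>C. (b \<bullet> x) *\<^sub>R b) = x"
      using orthonormal_basis_expand[OF C(1) _ _ fin, of x] C(2,3) by (auto simp: inner_commute)
  qed (use C in auto)
qed

section \<open>Adjoints and the positive semidefinite square root\<close>

lemma inner_matrix_vector_mult:
  fixes A :: "real^'n^'m"
  shows "x \<bullet> (A *v y) = (transpose A *v x) \<bullet> y"
  by (simp add: dot_lmul_matrix transpose_matrix_vector)

lemma transpose_eq_self_iff:
  fixes A :: "real^'n^'n"
  shows "transpose A = A \<longleftrightarrow> (\<forall>x y. x \<bullet> (A *v y) = (A *v x) \<bullet> y)"
proof
  assume *: "\<forall>x y. x \<bullet> (A *v y) = (A *v x) \<bullet> y"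
  show "transpose A = A"
    unfolding matrix_eq by (metis * inner_matrix_vector_mult vector_eq_rdot)
qed (simp add: inner_matrix_vector_mult)

lemma pos_semidef_sqrt_exists:
  fixes P :: "real^'n^'n"
  assumes "pos_semidef P"
  shows "\<exists>S. pos_semidef S \<and> S ** S = P"
proof -
  have sym: "x \<bullet> (P *v y) = (P *v x) \<bullet> y" for x y
    using assms transpose_eq_self_iff by (auto simp: pos_semidef_def)
  obtain C l where C: "finite C" "\<And>b. b \<in> C \<Longrightarrow> norm b = 1" "pairwise orthogonal C"
    "\<And>b. b \<in> C \<Longrightarrow> P *v b = l b *\<^sub>R b" and expand: "\<And>x. (\<Sum>b\<in>C. (b \<bullet> x) *\<^sub>R b) = x"
    by (fact symmetric_eigenbasis[OF matrix_vector_mul_linear sym])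
  have l: "0 \<le> l b" if "b \<in> C" for b
  proof -
    have "0 \<le> b \<bullet> (P *v b)" using assms by (simp add: pos_semidef_def)
    then show ?thesis using C(2,4)[OF that] by (simp add: dot_square_norm)
  qed
  define s where "s x = (\<Sum>b\<in>C. (sqrt (l b) * (b \<bullet> x)) *\<^sub>R b)" for x
  have lin: "linear s"
    by (rule linearI) (simp_all add: s_def inner_add_right scaleR_sum_right sum.distrib algebra_simps)
  have s_basis: "s c = sqrt (l c) *\<^sub>R c" if "c \<in> C" for c
  proof -
    have "b \<bullet> c = (if b = c then 1 else 0)" if "b \<in> C" for b
      using C(2,3) that \<open>c \<in> C\<close> by (auto simp: pairwise_def orthogonal_def dot_square_norm)
    then have "s c = (\<Sum>b\<in>C. if b = c then sqrt (l c) *\<^sub>R c else 0)"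
      unfolding s_def by (intro sum.cong) auto
    then show ?thesis using C(1) that by simp
  qed
  have sq: "s (s x) = P *v x" for x
  proof -
    have "s (s x) = (\<Sum>b\<in>C. (sqrt (l b) * (b \<bullet> x)) *\<^sub>R s b)"
      by (subst s_def[of x]) (simp add: linear_sum[OF lin] linear_scale[OF lin])
    also have "\<dots> = (\<Sum>b\<in>C. (b \<bullet> x) *\<^sub>R (P *v b))"
      by (intro sum.cong) (simp_all add: s_basis C(4) l)
    also have "\<dots> = P *v (\<Sum>b\<in>C. (b \<bullet> x) *\<^sub>R b)"
      by (simp add: linear_sum[OF matrix_vector_mul_linear] matrix_vector_mult_scaleR)
    also have "\<dots> = P *v x" by (simp only: expand)
    finally show ?thesis .
  qed
  let ?S = "matrix s"
  have S: "?S *v x = s x" for x by (simp add: matrix_works lin)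
  have "transpose ?S = ?S"
    unfolding transpose_eq_self_iff S
    by (simp add: s_def inner_sum_left inner_sum_right inner_commute mult_ac)
  moreover have "0 \<le> x \<bullet> (?S *v x)" for x
    unfolding S s_def inner_sum_right
    by (intro sum_nonneg) (simp add: inner_commute[of x] mult.assoc l)
  moreover have "?S ** ?S = P"
    by (simp add: matrix_eq S sq matrix_vector_mul_assoc[symmetric])
  ultimately show ?thesis by (auto simp: pos_semidef_def)
qed

text \<open>Since \<open>S ** S\<close> minus r^2 factors, \<open>d\<close> satisfies (S + r) d = 0,
  and a semidefinite \<open>S\<close> has no negative eigenvalue; for r = 0 symmetry gives d = 0
  directly. The case r = 0 later yields the kernel of the square root.\<close>

lemma pos_semidef_sqrt_eigenvector:
  fixes S :: "real^'n^'n"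
  assumes S: "pos_semidef S" and r: "0 \<le> r" and c: "(S ** S) *v c = r\<^sup>2 *\<^sub>R c"
  shows "S *v c = r *\<^sub>R c"
proof -
  have sym: "x \<bullet> (S *v y) = (S *v x) \<bullet> y" for x y
    using S transpose_eq_self_iff by (auto simp: pos_semidef_def)
  have SS: "S *v (S *v c) = r\<^sup>2 *\<^sub>R c" using c by (simp add: matrix_vector_mul_assoc)
  define d where "d = S *v c - r *\<^sub>R c"
  have Sd: "S *v d = - r *\<^sub>R d"
    by (simp add: d_def matrix_vector_mult_diff_distrib matrix_vector_mult_scaleR SS
        power2_eq_square algebra_simps)
  have "d = 0"
  proof (cases "r = 0")
    case True
    then have "d \<bullet> d = c \<bullet> (S *v (S *v c))" by (simp add: d_def sym)
    then show ?thesis using True SS by simp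
  next
    case False
    have "0 \<le> d \<bullet> (S *v d)" using S by (simp add: pos_semidef_def)
    then have "d \<bullet> d \<le> 0" using False r unfolding Sd by (simp add: mult_le_0_iff)
    then show ?thesis by (metis inner_ge_zero inner_eq_zero_iff order_antisym)
  qed
  then show ?thesis by (simp add: d_def)
qed

text \<open>On an eigenbasis of \<open>R\<close> there is no freedom: the eigenvalues are
  non-negative, so \<open>pos_semidef_sqrt_eigenvector\<close> makes each basis vector an
  eigenvector of \<open>S\<close> with the same eigenvalue.\<close>

lemma pos_semidef_sqrt_unique:
  fixes S R :: "real^'n^'n"
  assumes S: "pos_semidef S" and R: "pos_semidef R" and eq: "S ** S = R ** R"
  shows "S = R"
proof -
  have sym: "x \<bullet> (R *v y) = (R *v x) \<bullet> y" for x y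
    using R transpose_eq_self_iff by (auto simp: pos_semidef_def)
  obtain C l where "finite C" and C: "\<And>b. b \<in> C \<Longrightarrow> norm b = 1"
    and "pairwise orthogonal C" and R_basis: "\<And>b. b \<in> C \<Longrightarrow> R *v b = l b *\<^sub>R b" and expand: "\<And>x. (\<Sum>b\<in>C. (b \<bullet> x) *\<^sub>R b) = x"
    by (fact symmetric_eigenbasis[OF matrix_vector_mul_linear sym])
  have basis: "S *v b = R *v b" if b: "b \<in> C" for b
  proof -
    have "0 \<le> b \<bullet> (R *v b)" using R by (simp add: pos_semidef_def)
    then have "0 \<le> l b" using C[OF b] R_basis[OF b] by (simp add: dot_square_norm)
    moreover have "(S ** S) *v b = (l b)\<^sup>2 *\<^sub>R b"
      unfolding eq matrix_vector_mul_assoc[symmetric]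
      by (simp add: R_basis[OF b] matrix_vector_mult_scaleR power2_eq_square)
    ultimately show ?thesis using pos_semidef_sqrt_eigenvector[OF S] R_basis[OF b] by simp
  qed
  have "S *v (\<Sum>b\<in>C. (b \<bullet> x) *\<^sub>R b) = R *v (\<Sum>b\<in>C. (b \<bullet> x) *\<^sub>R b)" for x
    by (simp add: linear_sum[OF matrix_vector_mul_linear] matrix_vector_mult_scaleR basis)
  then have "S *v x = R *v x" for x unfolding expand .
  then show ?thesis by (simp add: matrix_eq)
qed

lemma psd_sqrt:
  assumes "pos_semidef P"
  shows "pos_semidef (psd_sqrt P)" "psd_sqrt P ** psd_sqrt P = P"
proof -
  have "\<exists>!S. pos_semidef S \<and> S ** S = P"
    using pos_semidef_sqrt_exists[OF assms] pos_semidef_sqrt_unique by metis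
  then have "pos_semidef (psd_sqrt P) \<and> psd_sqrt P ** psd_sqrt P = P"
    unfolding psd_sqrt_def by (rule theI')
  then show "pos_semidef (psd_sqrt P)" "psd_sqrt P ** psd_sqrt P = P" by auto
qed

section \<open>Singular values as bounds on norms\<close>

text \<open>The basis consists of right singular vectors, an orthonormal eigenbasis of
  \<open>transpose A ** A\<close>. By Parseval both squared norms are weighted sums over the same
  coordinates, so norm bounds reduce to bounds on the weights.\<close>

lemma singular_value_basis:
  fixes A :: "real^'n^'n"
  obtains C s where "finite C" "\<And>b. b \<in> C \<Longrightarrow> s b \<in> singular_values A"
    "\<And>b. b \<in> C \<Longrightarrow> norm (A *v b) = s b"
    "\<And>x. (norm x)\<^sup>2 = (\<Sum>b\<in>C. (b \<bullet> x)\<^sup>2)"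
    "\<And>x. (norm (A *v x))\<^sup>2 = (\<Sum>b\<in>C. (s b)\<^sup>2 * (b \<bullet> x)\<^sup>2)"
proof -
  let ?T = "transpose A ** A"
  have inner_T: "x \<bullet> (?T *v y) = (A *v x) \<bullet> (A *v y)" for x y
    by (subst matrix_vector_mul_assoc[symmetric], subst inner_matrix_vector_mult) simp
  then have sym: "x \<bullet> (?T *v y) = (?T *v x) \<bullet> y" for x y by (metis inner_commute)
  obtain C l where C: "finite C" "\<And>b. b \<in> C \<Longrightarrow> norm b = 1" "pairwise orthogonal C"
    "\<And>b. b \<in> C \<Longrightarrow> ?T *v b = l b *\<^sub>R b" and expand: "\<And>x. (\<Sum>b\<in>C. (b \<bullet> x) *\<^sub>R b) = x"
    by (fact symmetric_eigenbasis[OF matrix_vector_mul_linear sym])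
  have l: "l b = (norm (A *v b))\<^sup>2" if "b \<in> C" for b
    using inner_T[of b b] C(2,4)[OF that] by (simp add: dot_square_norm)
  have "(\<Sum>b\<in>C. (b \<bullet> x) *\<^sub>R b) \<bullet> y = (\<Sum>b\<in>C. (b \<bullet> x) * (b \<bullet> y))" for x y
    by (simp add: inner_sum_left)
  then have parseval: "x \<bullet> y = (\<Sum>b\<in>C. (b \<bullet> x) * (b \<bullet> y))" for x y unfolding expand .
  show thesis
  proof (rule that[OF C(1), of "\<lambda>b. norm (A *v b)"])
    fix b assume b: "b \<in> C"
    then have "b \<noteq> 0" using C(2) by force
    then show "norm (A *v b) \<in> singular_values A"
      using C(4)[OF b] l[OF b] by (auto simp: singular_values_def)
  next
    fix x
    show "(norm x)\<^sup>2 = (\<Sum>b\<in>C. (b \<bullet> x)\<^sup>2)"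
      using parseval[of x x] by (simp add: dot_square_norm power2_eq_square)
    have "(norm (A *v x))\<^sup>2 = x \<bullet> (?T *v x)" by (simp add: inner_T dot_square_norm)
    also have "\<dots> = (\<Sum>b\<in>C. (b \<bullet> x) * ((?T *v b) \<bullet> x))" by (subst parseval) (simp only: sym)
    also have "\<dots> = (\<Sum>b\<in>C. (norm (A *v b))\<^sup>2 * (b \<bullet> x)\<^sup>2)"
      by (intro sum.cong) (simp_all add: C(4) l power2_eq_square)
    finally show "(norm (A *v x))\<^sup>2 = (\<Sum>b\<in>C. (norm (A *v b))\<^sup>2 * (b \<bullet> x)\<^sup>2)" .
  qed simp
qed

lemma norm_matrix_le_sigma_max:
  fixes A :: "real^'n^'n"
  shows "(norm (A *v x))\<^sup>2 \<le> (sigma_max A)\<^sup>2 * (norm x)\<^sup>2"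
proof -
  obtain C s where C: "finite C" "\<And>b. b \<in> C \<Longrightarrow> s b \<in> singular_values A"
    "\<And>b. b \<in> C \<Longrightarrow> norm (A *v b) = s b" "\<And>x. (norm x)\<^sup>2 = (\<Sum>b\<in>C. (b \<bullet> x)\<^sup>2)"
    "\<And>x. (norm (A *v x))\<^sup>2 = (\<Sum>b\<in>C. (s b)\<^sup>2 * (b \<bullet> x)\<^sup>2)"
    by (fact singular_value_basis[of A])
  have "(s b)\<^sup>2 \<le> (sigma_max A)\<^sup>2" if "b \<in> C" for b
    using C(2)[OF that] Max_ge[OF finite_singular_values[of A]]
    by (intro power_mono) (auto simp: sigma_max_def singular_values_def)
  then show ?thesis unfolding C(4)[of x] C(5)[of x] sum_distrib_left
    by (intro sum_mono mult_right_mono) auto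
qed

text \<open>For \<open>x\<close> orthogonal to the kernel, the coordinates at singular vectors with
  singular value 0 vanish, so only non-zero singular values contribute.\<close>

lemma norm_matrix_ge_sigma_min_nz:
  fixes A :: "real^'n^'n"
  assumes "\<And>z. A *v z = 0 \<Longrightarrow> z \<bullet> x = 0"
  shows "(sigma_min_nz A)\<^sup>2 * (norm x)\<^sup>2 \<le> (norm (A *v x))\<^sup>2"
proof -
  obtain C s where C: "finite C" "\<And>b. b \<in> C \<Longrightarrow> s b \<in> singular_values A"
    "\<And>b. b \<in> C \<Longrightarrow> norm (A *v b) = s b" "\<And>x. (norm x)\<^sup>2 = (\<Sum>b\<in>C. (b \<bullet> x)\<^sup>2)"
    "\<And>x. (norm (A *v x))\<^sup>2 = (\<Sum>b\<in>C. (s b)\<^sup>2 * (b \<bullet> x)\<^sup>2)"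
    by (fact singular_value_basis[of A])
  have "(sigma_min_nz A)\<^sup>2 * (b \<bullet> x)\<^sup>2 \<le> (s b)\<^sup>2 * (b \<bullet> x)\<^sup>2" if b: "b \<in> C" for b
  proof (cases "s b = 0")
    case True
    then show ?thesis using assms[of b] C(3)[OF b] by simp
  next
    case False
    let ?N = "{s \<in> singular_values A. s \<noteq> 0}"
    have fin: "finite ?N" by (simp add: finite_singular_values)
    \<comment> \<open>The witness makes \<open>?N\<close> non-empty, so that \<open>Min\<close> is
      attained in it.\<close>
    have sb: "s b \<in> ?N" using C(2)[OF b] False by simp
    then have "sigma_min_nz A \<in> ?N" unfolding sigma_min_nz_def using fin by (intro Min_in) auto
    moreover have "sigma_min_nz A \<le> s b" unfolding sigma_min_nz_def using fin sb by (rule Min_le)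
    ultimately have "(sigma_min_nz A)\<^sup>2 \<le> (s b)\<^sup>2"
      by (intro power_mono) (auto simp: singular_values_def)
    then show ?thesis by (rule mult_right_mono) simp
  qed
  then show ?thesis unfolding C(4)[of x] C(5)[of x] sum_distrib_left by (intro sum_mono)
qed

lemma sigma_min_nz_pos:
  fixes A :: "real^'n^'n"
  assumes "A \<noteq> 0"
  shows "0 < sigma_min_nz A"
proof -
  let ?N = "{s \<in> singular_values A. s \<noteq> 0}"
  obtain C s where C: "finite C" "\<And>b. b \<in> C \<Longrightarrow> s b \<in> singular_values A"
    "\<And>b. b \<in> C \<Longrightarrow> norm (A *v b) = s b" "\<And>x. (norm x)\<^sup>2 = (\<Sum>b\<in>C. (b \<bullet> x)\<^sup>2)"
    "\<And>x. (norm (A *v x))\<^sup>2 = (\<Sum>b\<in>C. (s b)\<^sup>2 * (b \<bullet> x)\<^sup>2)"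
    by (fact singular_value_basis[of A])
  have "?N \<noteq> {}"
  proof
    assume "?N = {}"
    then have "s b = 0" if "b \<in> C" for b using C(2)[OF that] by blast
    then have "(norm (A *v x))\<^sup>2 = 0" for x unfolding C(5) by simp
    then have "A = 0" by (simp add: matrix_eq)
    then show False using assms by simp
  qed
  moreover have "finite ?N" by (simp add: finite_singular_values)
  ultimately have "sigma_min_nz A \<in> ?N" unfolding sigma_min_nz_def by (rule Min_in[rotated])
  then show ?thesis by (auto simp: singular_values_def)
qed

text \<open>By symmetry the component \<open>b\<close> of \<open>x\<close> orthogonal to the range
  lies in the kernel. It is then orthogonal both to \<open>x\<close> and to the range component
  \<open>a\<close>, hence to itself.\<close>

lemma symmetric_range_eq_kernel_complement:
  fixes B :: "real^'n^'n"
  assumes sym: "transpose B = B" and x: "\<And>z. B *v z = 0 \<Longrightarrow> z \<bullet> x = 0"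
  shows "x \<in> range (\<lambda>z. B *v z)"
proof -
  let ?R = "range (\<lambda>z. B *v z)"
  have "subspace ?R" by (rule linear_subspace_image[OF matrix_vector_mul_linear subspace_UNIV])
  then obtain a b where ab: "a \<in> ?R" "\<And>c. c \<in> ?R \<Longrightarrow> orthogonal b c" "x = a + b"
    using orthogonal_subspace_decomp_exists[of ?R x] by (metis span_eq_iff)
  have "(B *v b) \<bullet> (B *v b) = b \<bullet> (B *v (B *v b))" by (simp add: inner_matrix_vector_mult sym)
  also have "\<dots> = 0" using ab(2) by (simp add: orthogonal_def)
  finally have "B *v b = 0" by simp
  then have "b \<bullet> x = 0" by (rule x)
  moreover have "b \<bullet> a = 0" using ab(1,2) by (simp add: orthogonal_def)
  ultimately have "b = 0" using ab(3) by (simp add: inner_add_right)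
  then show ?thesis using ab by simp
qed

section \<open>Gradients of smooth convex functions\<close>

text \<open>The adjoint of the derivative, applied to 1, is the Riesz representative that the
  description in \<open>gradient\<close> asks for.\<close>

lemma gderiv_gradient:
  fixes f :: "'a::euclidean_space \<Rightarrow> real"
  assumes "f differentiable (at x)"
  shows "GDERIV f x :> gradient f x"
proof -
  obtain f' where f': "(f has_derivative f') (at x)" using assms by (auto simp: differentiable_def)
  then have "f' h = h \<bullet> adjoint f' 1" for h
    by (simp add: adjoint_works has_derivative_linear)
  then have "f' = (\<lambda>h. h \<bullet> adjoint f' 1)" by (rule ext)
  with f' have "GDERIV f x :> adjoint f' 1" unfolding gderiv_def by metis
  then show ?thesis using gradient_eq by metis
qed

lemma gderiv_along_line:
  assumes "GDERIV f (x + t *\<^sub>R d) :> D"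
  shows "((\<lambda>t. f (x + t *\<^sub>R d)) has_real_derivative d \<bullet> D) (at t)"
proof -
  have "((\<lambda>t. x + t *\<^sub>R d) has_derivative (\<lambda>s. s *\<^sub>R d)) (at t)"
    by (auto intro!: derivative_eq_intros)
  from has_derivative_compose[OF this assms[unfolded gderiv_def]]
  show ?thesis by (simp add: has_field_derivative_def mult_commute_abs)
qed

lemma convex_on_imp_above_gradient:
  fixes f :: "'a::real_inner \<Rightarrow> real"
  assumes f: "convex_on UNIV f" and D: "GDERIV f x :> D"
  shows "f x + (y - x) \<bullet> D \<le> f y"
proof -
  let ?\<phi> = "\<lambda>t. f (x + t *\<^sub>R (y - x))"
  have "convex_on UNIV ?\<phi>"
  proof (rule convex_onI)
    fix t a b :: real assume t: "0 < t" "t < 1"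
    have "x + ((1 - t) *\<^sub>R a + t *\<^sub>R b) *\<^sub>R (y - x)
        = (1 - t) *\<^sub>R (x + a *\<^sub>R (y - x)) + t *\<^sub>R (x + b *\<^sub>R (y - x))"
      by (simp add: algebra_simps)
    then show "?\<phi> ((1 - t) *\<^sub>R a + t *\<^sub>R b) \<le> (1 - t) * ?\<phi> a + t * ?\<phi> b"
      using convex_onD[OF f, of t "x + a *\<^sub>R (y - x)" "x + b *\<^sub>R (y - x)"] t by simp
  qed simp
  moreover have "(?\<phi> has_real_derivative (y - x) \<bullet> D) (at 0)"
    by (rule gderiv_along_line) (use D in simp)
  ultimately have "?\<phi> 1 - ?\<phi> 0 \<ge> (y - x) \<bullet> D * (1 - 0)"
    by (intro convex_on_imp_above_tangent[where A = UNIV]) auto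
  then show ?thesis by simp
qed

text \<open>The descent lemma. Along the segment, \<open>?\<psi>\<close> is \<open>f\<close> minus
  the claimed linear and quadratic terms; Cauchy-Schwarz and the Lipschitz condition make its
  derivative non-positive.\<close>

lemma lipschitz_gradient_upper_bound:
  fixes f :: "'a::real_inner \<Rightarrow> real"
  assumes g: "\<And>x. GDERIV f x :> g x" and lip: "\<And>x y. norm (g x - g y) \<le> L * norm (x - y)"
  shows "f (x + d) \<le> f x + d \<bullet> g x + L / 2 * (norm d)\<^sup>2"
proof -
  let ?\<psi> = "\<lambda>t. f (x + t *\<^sub>R d) - t * (d \<bullet> g x) - L / 2 * (norm d)\<^sup>2 * t\<^sup>2"
  have "\<exists>y. (?\<psi> has_real_derivative y) (at t) \<and> y \<le> 0" if t: "0 \<le> t" for t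
  proof (intro exI conjI)
    show "(?\<psi> has_real_derivative d \<bullet> g (x + t *\<^sub>R d) - d \<bullet> g x - L / 2 * (norm d)\<^sup>2 * (2 * t)) (at t)"
      by (auto intro!: derivative_eq_intros gderiv_along_line g)
    have "d \<bullet> (g (x + t *\<^sub>R d) - g x) \<le> norm d * norm (g (x + t *\<^sub>R d) - g x)"
      by (rule norm_cauchy_schwarz)
    also have "\<dots> \<le> norm d * (L * norm (t *\<^sub>R d))"
      using lip[of "x + t *\<^sub>R d" x] by (intro mult_left_mono) auto
    finally show "d \<bullet> g (x + t *\<^sub>R d) - d \<bullet> g x - L / 2 * (norm d)\<^sup>2 * (2 * t) \<le> 0"
      using t by (simp add: inner_diff_right power2_eq_square mult_ac)
  qed
  then have "?\<psi> 1 \<le> ?\<psi> 0"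
    by (intro DERIV_nonpos_imp_nonincreasing[of 0 1 ?\<psi>]) auto
  then show ?thesis by (simp add: algebra_simps)
qed

text \<open>Subtracting the linear function with slope \<open>g x\<close> from \<open>f\<close>
  leaves a function minimal at \<open>x\<close>, and a step of length 1 / L from \<open>y\<close>
  along its negative gradient must not fall below that minimum. This gives \<open>half\<close>;
  adding \<open>half\<close> to itself with \<open>x\<close> and \<open>y\<close> swapped gives
  co-coercivity.\<close>

theorem baillon_haddad:
  fixes f :: "'a::real_inner \<Rightarrow> real"
  assumes g: "\<And>x. GDERIV f x :> g x" and lip: "\<And>x y. norm (g x - g y) \<le> L * norm (x - y)"
    and L: "0 < L" and tangent: "\<And>x y. f x + (y - x) \<bullet> g x \<le> f y"
  shows "(norm (g x - g y))\<^sup>2 \<le> L * ((g x - g y) \<bullet> (x - y))"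
proof -
  have half: "f x + (y - x) \<bullet> g x + (norm (g y - g x))\<^sup>2 / (2 * L) \<le> f y" for x y
  proof -
    define v where "v = g y - g x"
    let ?z = "y + (- (1 / L)) *\<^sub>R v"
    have "f x + (?z - x) \<bullet> g x \<le> f ?z" by (rule tangent)
    also have "f ?z \<le> f y + ((- (1 / L)) *\<^sub>R v) \<bullet> g y + L / 2 * (norm ((- (1 / L)) *\<^sub>R v))\<^sup>2"
      by (rule lipschitz_gradient_upper_bound[OF g lip])
    also have "L / 2 * (norm ((- (1 / L)) *\<^sub>R v))\<^sup>2 = (v \<bullet> v) / (2 * L)"
      using L by (simp add: dot_square_norm power2_eq_square)
    finally have "f x + (y - x) \<bullet> g x + ((v \<bullet> g y) - (v \<bullet> g x)) / L - (v \<bullet> v) / (2 * L) \<le> f y"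
      by (simp add: inner_diff_left inner_add_left diff_divide_distrib)
    moreover have "(v \<bullet> g y) - (v \<bullet> g x) = v \<bullet> v" by (simp add: v_def inner_diff_right)
    then have "((v \<bullet> g y) - (v \<bullet> g x)) / L = v \<bullet> v / (2 * L) + v \<bullet> v / (2 * L)"
      by simp
    ultimately show ?thesis unfolding v_def[symmetric] power2_norm_eq_inner by linarith
  qed
  have "(norm (g x - g y))\<^sup>2 / L \<le> (g x - g y) \<bullet> (x - y)"
    using half[of x y] half[of y x] L
    by (simp add: norm_minus_commute inner_diff_left inner_diff_right inner_commute field_simps)
  then show ?thesis using L by (simp add: field_simps)
qed

text \<open>Zeros of \<open>g\<close> are the fixed points of the gradient step x - t g(x), a
  contraction for suitable t.\<close>

lemma strongly_monotone_lipschitz_zero: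
  fixes g :: "'a::euclidean_space \<Rightarrow> 'a"
  assumes mono: "\<And>x y. \<nu> * (norm (x - y))\<^sup>2 \<le> (x - y) \<bullet> (g x - g y)"
    and lip: "\<And>x y. norm (g x - g y) \<le> L * norm (x - y)" and pos: "0 < \<nu>" "0 < L"
  shows "\<exists>x. g x = 0"
proof -
  \<comment> \<open>This choice minimizes the squared contraction factor 1 - 2 \<nu> t + L^2 t^2,
    whose value becomes 1 - \<nu> t. The \<open>max\<close> in \<open>c\<close> ensures a
    non-negative factor without comparing \<nu> and \<open>L\<close>.\<close>
  define t where "t = \<nu> / L\<^sup>2"
  define c where "c = sqrt (max 0 (1 - \<nu> * t))"
  have t: "0 < t" using pos by (simp add: t_def)
  have "dist (x - t *\<^sub>R g x) (y - t *\<^sub>R g y) \<le> c * dist x y" for x y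
  proof -
    have "(norm ((x - y) - t *\<^sub>R (g x - g y)))\<^sup>2
        = (norm (x - y))\<^sup>2 - 2 * t * ((x - y) \<bullet> (g x - g y)) + t\<^sup>2 * (norm (g x - g y))\<^sup>2"
      unfolding power2_norm_eq_inner
      by (simp add: inner_diff_left inner_diff_right inner_commute power2_eq_square algebra_simps)
    also have "\<dots> \<le> (norm (x - y))\<^sup>2 - 2 * t * (\<nu> * (norm (x - y))\<^sup>2) + t\<^sup>2 * (L * norm (x - y))\<^sup>2"
      using mono[of x y] lip[of x y] t by (intro add_mono diff_mono mult_left_mono power_mono) auto
    also have "\<dots> = (1 - \<nu> * t) * (norm (x - y))\<^sup>2"
      using pos by (simp add: t_def field_simps power2_eq_square)
    also have "\<dots> \<le> (c * norm (x - y))\<^sup>2"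
      by (auto simp: c_def power_mult_distrib intro!: mult_right_mono)
    finally have "norm ((x - y) - t *\<^sub>R (g x - g y)) \<le> c * norm (x - y)"
      by (rule power2_le_imp_le) (simp add: c_def)
    moreover have "(x - t *\<^sub>R g x) - (y - t *\<^sub>R g y) = (x - y) - t *\<^sub>R (g x - g y)"
      by (simp add: algebra_simps)
    ultimately show ?thesis by (simp only: dist_norm)
  qed
  moreover have "0 \<le> c" by (simp add: c_def)
  moreover have "c < 1" using pos t by (simp add: c_def)
  ultimately have "\<exists>!x. x - t *\<^sub>R g x = x" by (intro banach_fix_type[of c]) auto
  then show ?thesis using t by auto
qed

section \<open>Lyapunov analysis of the primal-dual recursion\<close>

text \<open>The coupling terms \<open>\<plusminus>2 \<mu>\<^sub>w (B d \<bullet> e')\<close> of the primal and the dual step cancel; the term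
  \<open>- \<mu>\<^sub>w \<mu>\<^sub>l \<parallel>B e\<parallel>\<^sup>2\<close> compensates the quadratic term of the dual step, which uses the new primal
  iterate.\<close>

definition lyapunov :: "('a \<Rightarrow> 'a) \<Rightarrow> real \<Rightarrow> real \<Rightarrow> 'a::real_inner \<Rightarrow> 'a \<Rightarrow> real" where
  "lyapunov B \<mu>\<^sub>w \<mu>\<^sub>l e d =
    (norm e)\<^sup>2 - \<mu>\<^sub>w * \<mu>\<^sub>l * (norm (B e))\<^sup>2 + \<mu>\<^sub>w / \<mu>\<^sub>l * (norm d)\<^sup>2"

text \<open>Makes the Lyapunov function a genuine measure of the errors. With \<open>d = 0\<close>
  it bounds the primal part alone.\<close>

lemma lyapunov_lower_bound:
  assumes upper: "(norm (B e))\<^sup>2 \<le> S * (norm e)\<^sup>2"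
    and step: "\<mu>\<^sub>l * S \<le> \<nu>" and pos: "0 < \<mu>\<^sub>w" "0 < \<mu>\<^sub>l"
  shows "(1 - \<mu>\<^sub>w * \<nu>) * (norm e)\<^sup>2 + \<mu>\<^sub>w / \<mu>\<^sub>l * (norm d)\<^sup>2 \<le> lyapunov B \<mu>\<^sub>w \<mu>\<^sub>l e d"
proof -
  have "\<mu>\<^sub>l * (norm (B e))\<^sup>2 \<le> \<mu>\<^sub>l * S * (norm e)\<^sup>2"
    using upper pos by (simp add: mult.assoc)
  also have "\<dots> \<le> \<nu> * (norm e)\<^sup>2" using step by (rule mult_right_mono) simp
  finally have "\<mu>\<^sub>w * (\<mu>\<^sub>l * (norm (B e))\<^sup>2) \<le> \<mu>\<^sub>w * (\<nu> * (norm e)\<^sup>2)"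
    using pos by simp
  then show ?thesis unfolding lyapunov_def by (simp add: algebra_simps)
qed

text \<open>The new value equals a primal expression in \<open>e\<close> plus a dual one in
  \<open>d\<close>, without mixed terms; each contracts by its own factor and the larger factor
  governs the sum.\<close>

lemma lyapunov_contraction:
  fixes e d g :: "'a::real_inner"
  assumes sym: "\<And>u v. u \<bullet> B v = B u \<bullet> v"
    and upper: "(norm (B e))\<^sup>2 \<le> S * (norm e)\<^sup>2"
    and lower: "s * (norm d)\<^sup>2 \<le> (norm (B d))\<^sup>2"
    and coco: "(norm g)\<^sup>2 \<le> L * (g \<bullet> e)" and mono: "\<nu> * (norm e)\<^sup>2 \<le> g \<bullet> e"
    and pos: "0 < \<nu>" "0 < \<mu>\<^sub>w" "0 < \<mu>\<^sub>l" and \<nu>: "\<nu> \<le> L"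
    and step: "\<mu>\<^sub>w * L < 1" "\<mu>\<^sub>l * S \<le> \<nu>"
    and e': "e' = e - \<mu>\<^sub>w *\<^sub>R g - \<mu>\<^sub>w *\<^sub>R B d" and d': "d' = d + \<mu>\<^sub>l *\<^sub>R B e'"
  shows "lyapunov B \<mu>\<^sub>w \<mu>\<^sub>l e' d' \<le>
    max (1 - \<mu>\<^sub>w * \<nu> * (1 - \<mu>\<^sub>w * L)) (1 - \<mu>\<^sub>w * \<mu>\<^sub>l * s) * lyapunov B \<mu>\<^sub>w \<mu>\<^sub>l e d"
    (is "_ \<le> max ?p ?q * _")
proof -
  define z where "z = e - \<mu>\<^sub>w *\<^sub>R g"
  define X where "X = (norm e)\<^sup>2 - \<mu>\<^sub>w * \<mu>\<^sub>l * (norm (B e))\<^sup>2"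
  have \<mu>\<nu>: "\<mu>\<^sub>w * \<nu> \<le> \<mu>\<^sub>w * L" using \<nu> pos by simp
  have X: "(1 - \<mu>\<^sub>w * \<nu>) * (norm e)\<^sup>2 \<le> X"
    using lyapunov_lower_bound[where B = B and d = 0, OF upper step(2) pos(2,3)] by (simp add: X_def lyapunov_def)
  have \<mu>\<nu>1: "\<mu>\<^sub>w * \<nu> \<le> 1" using \<mu>\<nu> step(1) by linarith
  then have "0 \<le> (1 - \<mu>\<^sub>w * \<nu>) * (norm e)\<^sup>2" by simp
  then have X_nonneg: "0 \<le> X" using X by linarith
  have "\<mu>\<^sub>w * \<nu> * (1 - \<mu>\<^sub>w * L) \<le> 1 * 1"
    using \<mu>\<nu>1 step(1) pos \<nu> by (intro mult_mono) auto
  then have p: "0 \<le> ?p" by simp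
  have "d \<bullet> B e' = B d \<bullet> e'" "B e' \<bullet> d = B d \<bullet> e'"
    using sym[of d e'] by (simp_all add: inner_commute)
  then have d_eq: "(norm d')\<^sup>2 = (norm d)\<^sup>2 + 2 * \<mu>\<^sub>l * (B d \<bullet> e') + \<mu>\<^sub>l\<^sup>2 * (norm (B e'))\<^sup>2"
    unfolding d' power2_norm_eq_inner
    by (simp add: inner_add_left inner_add_right power2_eq_square algebra_simps)
  have "z = e' + \<mu>\<^sub>w *\<^sub>R B d" by (simp add: z_def e')
  then have z_eq: "(norm z)\<^sup>2 = (norm e')\<^sup>2 + 2 * \<mu>\<^sub>w * (B d \<bullet> e') + \<mu>\<^sub>w\<^sup>2 * (norm (B d))\<^sup>2"
    unfolding power2_norm_eq_inner
    by (simp add: inner_add_left inner_add_right inner_commute power2_eq_square algebra_simps)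
  have "\<mu>\<^sub>w / \<mu>\<^sub>l * (norm d')\<^sup>2
      = \<mu>\<^sub>w / \<mu>\<^sub>l * (norm d)\<^sup>2 + 2 * \<mu>\<^sub>w * (B d \<bullet> e') + \<mu>\<^sub>w * \<mu>\<^sub>l * (norm (B e'))\<^sup>2"
    unfolding d_eq using pos by (simp add: field_simps power2_eq_square)
  \<comment> \<open>The weight \<open>\<mu>\<^sub>w / \<mu>\<^sub>l\<close> gives both mixed terms
    the same coefficient. Expressing \<open>e'\<close> through the pure gradient step
    \<open>z\<close> leaves the negative term in \<open>B d\<close>, the source of the dual
    decrease.\<close>
  then have V: "lyapunov B \<mu>\<^sub>w \<mu>\<^sub>l e' d'
      = (norm z)\<^sup>2 + (\<mu>\<^sub>w / \<mu>\<^sub>l * (norm d)\<^sup>2 - \<mu>\<^sub>w\<^sup>2 * (norm (B d))\<^sup>2)"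
    unfolding lyapunov_def z_eq by simp
  have "(norm z)\<^sup>2 = (norm e)\<^sup>2 - 2 * \<mu>\<^sub>w * (g \<bullet> e) + \<mu>\<^sub>w\<^sup>2 * (norm g)\<^sup>2"
    unfolding z_def power2_norm_eq_inner
    by (simp add: inner_diff_left inner_diff_right inner_commute power2_eq_square algebra_simps)
  also have "\<dots> \<le> (norm e)\<^sup>2 - 2 * \<mu>\<^sub>w * (g \<bullet> e) + \<mu>\<^sub>w\<^sup>2 * (L * (g \<bullet> e))"
    using coco by (intro add_left_mono mult_left_mono) auto
  also have "\<dots> = (norm e)\<^sup>2 - \<mu>\<^sub>w * (2 - \<mu>\<^sub>w * L) * (g \<bullet> e)"
    by (simp add: power2_eq_square algebra_simps)
  also have "\<dots> \<le> (norm e)\<^sup>2 - \<mu>\<^sub>w * (2 - \<mu>\<^sub>w * L) * (\<nu> * (norm e)\<^sup>2)"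
    using mono pos step(1) by (intro diff_left_mono mult_left_mono) auto
  \<comment> \<open>Of the 2 in \<open>2 - \<mu>\<^sub>w * L\<close>, one unit pays for the factor
    \<open>1 - \<mu>\<^sub>w * \<nu>\<close> by which \<open>X\<close> may fall short of the squared
    norm of \<open>e\<close>; the rest yields the rate \<open>?p\<close>.\<close>
  also have "\<dots> = ?p * (1 - \<mu>\<^sub>w * \<nu>) * (norm e)\<^sup>2 - (\<mu>\<^sub>w * \<nu>)\<^sup>2 * (1 - \<mu>\<^sub>w * L) * (norm e)\<^sup>2"
    by (simp add: power2_eq_square algebra_simps)
  also have "\<dots> \<le> ?p * ((1 - \<mu>\<^sub>w * \<nu>) * (norm e)\<^sup>2)"
    using step(1) by simp
  also have "\<dots> \<le> ?p * X" using X p by (rule mult_left_mono)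
  also have "\<dots> \<le> max ?p ?q * X" using X_nonneg by (intro mult_right_mono) auto
  finally have 1: "(norm z)\<^sup>2 \<le> max ?p ?q * X" .
  have "\<mu>\<^sub>w / \<mu>\<^sub>l * (norm d)\<^sup>2 - \<mu>\<^sub>w\<^sup>2 * (norm (B d))\<^sup>2
      \<le> \<mu>\<^sub>w / \<mu>\<^sub>l * (norm d)\<^sup>2 - \<mu>\<^sub>w\<^sup>2 * (s * (norm d)\<^sup>2)"
    using lower by (intro diff_left_mono mult_left_mono) auto
  also have "\<dots> = ?q * (\<mu>\<^sub>w / \<mu>\<^sub>l * (norm d)\<^sup>2)"
    using pos by (simp add: field_simps power2_eq_square)
  also have "\<dots> \<le> max ?p ?q * (\<mu>\<^sub>w / \<mu>\<^sub>l * (norm d)\<^sup>2)"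
    using pos by (intro mult_right_mono) auto
  finally have 2: "\<mu>\<^sub>w / \<mu>\<^sub>l * (norm d)\<^sup>2 - \<mu>\<^sub>w\<^sup>2 * (norm (B d))\<^sup>2
      \<le> max ?p ?q * (\<mu>\<^sub>w / \<mu>\<^sub>l * (norm d)\<^sup>2)" .
  have "lyapunov B \<mu>\<^sub>w \<mu>\<^sub>l e d = X + \<mu>\<^sub>w / \<mu>\<^sub>l * (norm d)\<^sup>2" by (simp add: lyapunov_def X_def)
  then show ?thesis unfolding V using 1 2 by (simp add: distrib_left)
qed

text \<open>Both estimates are tested at a displacement by a unit vector and compared through
  Cauchy-Schwarz. The result places \<open>\<mu>\<^sub>w * \<nu>\<close> below 1 once
  \<open>\<mu>\<^sub>w * L\<close> is.\<close>

lemma strongly_monotone_le_cocoercive: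
  fixes G :: "'a::euclidean_space \<Rightarrow> 'a"
  assumes coco: "\<And>x. (norm (G x - G a))\<^sup>2 \<le> L * ((G x - G a) \<bullet> (x - a))"
    and mono: "\<And>x. \<nu> * (norm (x - a))\<^sup>2 \<le> (G x - G a) \<bullet> (x - a)" and pos: "0 < \<nu>" "0 < L"
  shows "\<nu> \<le> L"
proof -
  obtain b :: 'a where b: "b \<in> Basis" using nonempty_Basis by blast
  define q where "q = G (a + b) - G a"
  have "q \<bullet> b \<le> norm q" using norm_cauchy_schwarz[of q b] b by simp
  moreover have "\<nu> \<le> q \<bullet> b" using mono[of "a + b"] b by (simp add: q_def)
  moreover have "(norm q)\<^sup>2 \<le> L * (q \<bullet> b)" using coco[of "a + b"] by (simp add: q_def)
  moreover have "L * (q \<bullet> b) \<le> L * norm q" using calculation(1) pos by simp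
  ultimately have q: "\<nu> \<le> norm q" "norm q * norm q \<le> L * norm q"
    unfolding power2_eq_square by linarith+
  have "0 < norm q" using q(1) pos(1) by linarith
  then have "norm q \<le> L" using q(2) by (simp only: mult_le_cancel_right_pos)
  with q(1) show ?thesis by linarith
qed

text \<open>Co-coercivity and strong monotonicity enter only against the solution \<open>ws\<close>,
  so the penalized and the unpenalized recursion are both instances.\<close>

theorem primal_dual_linear_convergence:
  fixes B G :: "'a::euclidean_space \<Rightarrow> 'a" and w y :: "int \<Rightarrow> 'a"
  assumes lin: "linear B" and sym: "\<And>u v. u \<bullet> B v = B u \<bullet> v"
    and upper: "\<And>x. (norm (B x))\<^sup>2 \<le> S * (norm x)\<^sup>2"
    and lower: "\<And>x. x \<in> range B \<Longrightarrow> s * (norm x)\<^sup>2 \<le> (norm (B x))\<^sup>2"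
    and coco: "\<And>x. (norm (G x - G ws))\<^sup>2 \<le> L * ((G x - G ws) \<bullet> (x - ws))"
    and mono: "\<And>x. \<nu> * (norm (x - ws))\<^sup>2 \<le> (G x - G ws) \<bullet> (x - ws)"
    and pos: "0 < S" "0 < s" "0 < L" "0 < \<nu>" "0 < \<mu>\<^sub>w" "0 < \<mu>\<^sub>l"
    and step: "\<mu>\<^sub>w < 1 / L" "\<mu>\<^sub>l \<le> \<nu> / S"
    and opt: "G ws + B l = 0" "l \<in> range B" "B ws = 0"
    and y_init: "y (-1) = 0"
    and w_rec: "\<And>i. 0 \<le> i \<Longrightarrow> w i = w (i - 1) - \<mu>\<^sub>w *\<^sub>R G (w (i - 1)) - \<mu>\<^sub>w *\<^sub>R y (i - 1)"
    and y_rec: "\<And>i. 0 \<le> i \<Longrightarrow> y i = y (i - 1) + \<mu>\<^sub>l *\<^sub>R B (B (w i))"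
  shows "converges_linearly w y ws (B l)
    (max (1 - \<mu>\<^sub>w * \<nu> * (1 - \<mu>\<^sub>w * L)) (1 - \<mu>\<^sub>w * \<mu>\<^sub>l * s))"
proof -
  define \<gamma> where "\<gamma> = max (1 - \<mu>\<^sub>w * \<nu> * (1 - \<mu>\<^sub>w * L)) (1 - \<mu>\<^sub>w * \<mu>\<^sub>l * s)"
  have \<nu>: "\<nu> \<le> L" by (rule strongly_monotone_le_cocoercive[OF coco mono pos(4,3)])
  have step': "\<mu>\<^sub>w * L < 1" "\<mu>\<^sub>l * S \<le> \<nu>" using step pos by (simp_all add: field_simps)
  have \<mu>\<nu>: "\<mu>\<^sub>w * \<nu> \<le> \<mu>\<^sub>w * L" using \<nu> pos by simp
  define c where "c = 1 - \<mu>\<^sub>w * \<nu>"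
  have c: "0 < c" using \<mu>\<nu> step'(1) by (simp add: c_def)
  have "\<mu>\<^sub>w * \<nu> \<le> 1" using \<mu>\<nu> step'(1) by linarith
  moreover have "0 \<le> \<mu>\<^sub>w * L" using pos by simp
  ultimately have "\<mu>\<^sub>w * \<nu> * (1 - \<mu>\<^sub>w * L) \<le> 1 * 1" using step'(1) by (intro mult_mono) auto
  then have \<gamma>0: "0 \<le> \<gamma>" by (simp add: \<gamma>_def)
  have \<gamma>1: "\<gamma> < 1" using pos step'(1) by (simp add: \<gamma>_def)

  \<comment> \<open>The shift lets the natural number 0 stand for the starting index -1.\<close>
  define W where "W n = w (int n - 1)" for n
  \<comment> \<open>The dual recursion unrolled from 0 and written as an image under
    \<open>B\<close>, which makes membership in \<open>range B\<close> immediate.\<close>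
  define lam where "lam n = B (\<mu>\<^sub>l *\<^sub>R (\<Sum>j<n. W (Suc j)))" for n
  have lam_Suc: "lam (Suc n) = lam n + \<mu>\<^sub>l *\<^sub>R B (W (Suc n))" for n
    by (simp add: lam_def linear_add[OF lin] linear_scale[OF lin] scaleR_add_right)
  have Y: "y (int n - 1) = B (lam n)" for n
  proof (induction n)
    case 0
    then show ?case using y_init by (simp add: lam_def linear_0[OF lin])
  next
    case (Suc n)
    then show ?case using y_rec[of "int n"]
      by (simp add: lam_Suc linear_add[OF lin] linear_scale[OF lin] W_def)
  qed
  have W_Suc: "W (Suc n) = W n - \<mu>\<^sub>w *\<^sub>R G (W n) - \<mu>\<^sub>w *\<^sub>R B (lam n)" for n
    using w_rec[of "int n"] by (simp add: W_def Y)
  define E where "E n = W n - ws" for n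
  define D where "D n = lam n - l" for n
  have B_diff: "B (u - v) = B u - B v" for u v by (rule linear_diff[OF lin])
  have D_Suc: "D (Suc n) = D n + \<mu>\<^sub>l *\<^sub>R B (E (Suc n))" for n
    by (simp add: D_def E_def lam_Suc B_diff opt(3))
  have "G ws = - B l" using opt(1) by (simp add: eq_neg_iff_add_eq_0)
  then have E_Suc: "E (Suc n) = E n - \<mu>\<^sub>w *\<^sub>R (G (W n) - G ws) - \<mu>\<^sub>w *\<^sub>R B (D n)" for n
    by (simp add: D_def E_def W_Suc B_diff algebra_simps)
  have D_range: "D n \<in> range B" for n
    using opt(2) by (auto simp: D_def lam_def B_diff[symmetric])

  define V where "V n = lyapunov B \<mu>\<^sub>w \<mu>\<^sub>l (E n) (D n)" for n
  have V_Suc: "V (Suc n) \<le> \<gamma> * V n" for n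
    unfolding V_def \<gamma>_def
    by (rule lyapunov_contraction[OF sym upper lower[OF D_range] _ _ pos(4-6) \<nu> step' E_Suc D_Suc])
      (use coco mono in \<open>simp_all add: E_def\<close>)
  have V_le: "V n \<le> \<gamma> ^ n * V 0" for n
  proof (induction n)
    case (Suc n)
    have "V (Suc n) \<le> \<gamma> * (\<gamma> ^ n * V 0)"
      using V_Suc[of n] mult_left_mono[OF Suc \<gamma>0] by linarith
    then show ?case by simp
  qed simp
  have V_ge: "c * (norm (E n))\<^sup>2 + \<mu>\<^sub>w / \<mu>\<^sub>l * (norm (D n))\<^sup>2 \<le> V n" for n
    unfolding c_def V_def by (rule lyapunov_lower_bound[OF upper step'(2) pos(5,6)])
  have E_nonneg: "0 \<le> c * (norm (E n))\<^sup>2" and D_nonneg: "0 \<le> \<mu>\<^sub>w / \<mu>\<^sub>l * (norm (D n))\<^sup>2" for n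
    using c pos by simp_all
  have V_nonneg: "0 \<le> V n" for n
    using V_ge[of n] E_nonneg[of n] D_nonneg[of n] by linarith
  \<comment> \<open>Returns from \<open>V\<close> to the errors of the statement:
    \<open>1 / c\<close> undoes the primal weight, \<open>\<mu>\<^sub>l / \<mu>\<^sub>w\<close> the
    dual one, and \<open>S\<close> pays for passing from \<open>D n\<close> to
    \<open>B (D n)\<close>.\<close>
  define r where "r = 1 / c + S * \<mu>\<^sub>l / \<mu>\<^sub>w"
  have bound: "(norm (E n))\<^sup>2 + (norm (B (D n)))\<^sup>2 \<le> r * V n" for n
  proof -
    have "c * (norm (E n))\<^sup>2 \<le> V n" using V_ge[of n] D_nonneg[of n] by linarith
    then have 1: "(norm (E n))\<^sup>2 \<le> 1 / c * V n" using c by (simp add: field_simps)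
    have "\<mu>\<^sub>w / \<mu>\<^sub>l * (norm (D n))\<^sup>2 \<le> V n" using V_ge[of n] E_nonneg[of n] by linarith
    then have "(norm (D n))\<^sup>2 \<le> \<mu>\<^sub>l / \<mu>\<^sub>w * V n" using pos by (simp add: field_simps)
    then have "S * (norm (D n))\<^sup>2 \<le> S * (\<mu>\<^sub>l / \<mu>\<^sub>w * V n)" using pos by (intro mult_left_mono) auto
    then have "(norm (B (D n)))\<^sup>2 \<le> S * \<mu>\<^sub>l / \<mu>\<^sub>w * V n" using upper[of "D n"] by simp
    with 1 show ?thesis by (simp add: r_def distrib_right)
  qed
  have r: "0 \<le> r" using c pos by (simp add: r_def)
  \<comment> \<open>Iterate \<open>i\<close> is entry \<open>Suc i\<close> of the shifted sequences,
    whence the extra \<gamma> in the constant.\<close>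
  have "(norm (w (int i) - ws))\<^sup>2 + (norm (y (int i) - B l))\<^sup>2 \<le> r * \<gamma> * V 0 * \<gamma> ^ i" for i :: nat
  proof -
    have "(norm (w (int i) - ws))\<^sup>2 + (norm (y (int i) - B l))\<^sup>2 \<le> r * V (Suc i)"
      using bound[of "Suc i"] Y[of "Suc i"] by (simp add: E_def D_def W_def B_diff)
    also have "\<dots> \<le> r * (\<gamma> ^ Suc i * V 0)" using V_le r by (rule mult_left_mono)
    finally show ?thesis by (simp add: mult_ac)
  qed
  moreover have "0 \<le> r * \<gamma> * V 0" using r \<gamma>0 V_nonneg by simp
  ultimately show ?thesis
    unfolding converges_linearly_def \<gamma>_def[symmetric] using \<gamma>1 by blast
qed

section \<open>Network costs and the consensus kernel\<close>

lemma linear_block: "linear (\<lambda>x. block x k)"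
  by (rule linearI) (simp_all add: block_def vec_eq_iff)

lemma block_diff: "block (x - y) k = block x k - block y k"
  by (simp add: block_def vec_eq_iff)

lemma block_col [simp]: "block (col f) k = f k"
  by (simp add: block_def col_def vec_eq_iff)

lemma inner_eq_sum_block: "x \<bullet> y = (\<Sum>k\<in>UNIV. block x k \<bullet> block y k)"
  unfolding inner_vec_def block_def UNIV_Times_UNIV[symmetric]
  by (simp add: sum.cartesian_product split_def)

lemma power2_norm_eq_sum_block: "(norm x)\<^sup>2 = (\<Sum>k\<in>UNIV. (norm (block x k))\<^sup>2)"
  by (simp add: power2_norm_eq_inner inner_eq_sum_block)

text \<open>An explicit candidate for the gradient of \<open>network_cost J\<close>, to be confirmed
  by \<open>gderiv_network_cost\<close>; it allows blockwise computation in place of the description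
  in \<open>gradient\<close>.\<close>

definition network_gradient ::
  "('k::finite \<Rightarrow> real^'m \<Rightarrow> real) \<Rightarrow> real^('k \<times> 'm) \<Rightarrow> real^('k \<times> 'm)" where
  "network_gradient J w = col (\<lambda>k. gradient (J k) (block w k))"

lemma block_network_gradient [simp]:
  "block (network_gradient J w) k = gradient (J k) (block w k)"
  by (simp add: network_gradient_def)

lemma smooth_fun_gderiv:
  fixes f :: "'a::euclidean_space \<Rightarrow> real"
  assumes "smooth_fun \<delta> f"
  shows "GDERIV f x :> gradient f x"
  using assms by (intro gderiv_gradient) (simp add: smooth_fun_def differentiable_on_def)

lemma gderiv_network_cost:
  assumes "\<And>k. smooth_fun \<delta> (J k)"
  shows "GDERIV (network_cost J) w :> network_gradient J w"
proof -
  have "((\<lambda>w. J k (block w k)) has_derivative (\<lambda>h. block h k \<bullet> gradient (J k) (block w k))) (at w)" for k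
    using has_derivative_compose[OF
        bounded_linear_imp_has_derivative[OF linear_block[of k, unfolded linear_conv_bounded_linear]]
        smooth_fun_gderiv[OF assms[of k], unfolded gderiv_def]] by simp
  then show ?thesis
    unfolding gderiv_def network_cost_def inner_eq_sum_block block_network_gradient
    by (intro has_derivative_sum) simp
qed

lemma gderiv_augmented_cost:
  assumes "\<And>k. smooth_fun \<delta> (J k)"
  shows "GDERIV (augmented_cost J B \<rho>) w :> network_gradient J w + \<rho> *\<^sub>R (transpose B *v (B *v w))"
proof -
  have B: "((\<lambda>w. B *v w) has_derivative (\<lambda>h. B *v h)) (at w)"
    by (rule bounded_linear_imp_has_derivative) (rule matrix_vector_mul_bounded_linear)
  have "((\<lambda>w. network_cost J w + \<rho> / 2 * ((B *v w) \<bullet> (B *v w))) has_derivative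
      (\<lambda>h. h \<bullet> network_gradient J w + \<rho> / 2 * ((B *v w) \<bullet> (B *v h) + (B *v h) \<bullet> (B *v w)))) (at w)"
    by (intro has_derivative_add has_derivative_mult_right has_derivative_inner B
        gderiv_network_cost[where J = J, OF assms, unfolded gderiv_def])
  moreover have "(B *v w) \<bullet> (B *v h) = h \<bullet> (transpose B *v (B *v w))" for h
    by (subst inner_matrix_vector_mult) (rule inner_commute)
  moreover have "(B *v h) \<bullet> (B *v w) = h \<bullet> (transpose B *v (B *v w))" for h
    by (subst inner_commute, subst inner_matrix_vector_mult) (rule inner_commute)
  ultimately show ?thesis
    unfolding gderiv_def augmented_cost_def power2_norm_eq_inner
    by (simp add: inner_add_right)
qed

lemma gderiv_aggregate_cost:
  fixes J :: "'k::finite \<Rightarrow> real^'m \<Rightarrow> real"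
  assumes "\<And>k. smooth_fun \<delta> (J k)"
  shows "GDERIV (aggregate_cost J) v :> (1 / real CARD('k)) *\<^sub>R (\<Sum>k\<in>UNIV. gradient (J k) v)"
proof -
  have "((\<lambda>v. 1 / real CARD('k) * (\<Sum>k\<in>UNIV. J k v)) has_derivative
      (\<lambda>h. 1 / real CARD('k) * (\<Sum>k\<in>UNIV. h \<bullet> gradient (J k) v))) (at v)"
    by (intro has_derivative_mult_right has_derivative_sum)
      (rule smooth_fun_gderiv[OF assms, unfolded gderiv_def])
  then show ?thesis
    unfolding gderiv_def aggregate_cost_def by (simp add: inner_sum_right)
qed

lemma network_cost_above_gradient:
  assumes "\<And>k. convex_on UNIV (J k)" "\<And>k. smooth_fun \<delta> (J k)"
  shows "network_cost J x + (y - x) \<bullet> network_gradient J x \<le> network_cost J y"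
  unfolding network_cost_def inner_eq_sum_block block_network_gradient sum.distrib[symmetric] block_diff
  by (intro sum_mono convex_on_imp_above_gradient assms(1) smooth_fun_gderiv[OF assms(2)])

text \<open>The quadratic penalty exceeds its tangent by \<rho> / 2 times the squared norm of
  \<open>B *v (y - x)\<close>, which is added to the tangent inequality of
  \<open>network_cost J\<close>.\<close>

lemma augmented_cost_above_gradient:
  assumes "\<And>k. convex_on UNIV (J k)" "\<And>k. smooth_fun \<delta> (J k)" and \<rho>: "0 \<le> \<rho>"
  shows "augmented_cost J B \<rho> x + (y - x) \<bullet> (network_gradient J x + \<rho> *\<^sub>R (transpose B *v (B *v x)))
    \<le> augmented_cost J B \<rho> y"
proof -
  have eq: "(y - x) \<bullet> (transpose B *v (B *v x)) = (B *v x) \<bullet> (B *v y) - (norm (B *v x))\<^sup>2"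
    by (subst inner_matrix_vector_mult)
      (simp only: transpose_transpose matrix_vector_mult_diff_distrib inner_diff_left inner_diff_right
        power2_norm_eq_inner inner_commute)
  have "0 \<le> \<rho> * (norm (B *v y - B *v x))\<^sup>2" using \<rho> by simp
  also have "(norm (B *v y - B *v x))\<^sup>2
      = (norm (B *v y))\<^sup>2 - 2 * ((B *v x) \<bullet> (B *v y)) + (norm (B *v x))\<^sup>2"
    by (simp add: power2_norm_eq_inner inner_diff_left inner_diff_right inner_commute)
  finally have "\<rho> / 2 * (norm (B *v x))\<^sup>2 + \<rho> * ((y - x) \<bullet> (transpose B *v (B *v x)))
      \<le> \<rho> / 2 * (norm (B *v y))\<^sup>2"
    unfolding eq by (simp add: algebra_simps)
  then show ?thesis
    using network_cost_above_gradient[where J = J, OF assms(1,2), of x y]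
    by (simp add: augmented_cost_def inner_add_right)
qed

lemma network_gradient_lipschitz:
  assumes "\<And>k. smooth_fun \<delta> (J k)"
  shows "norm (network_gradient J x - network_gradient J y) \<le> \<delta> * norm (x - y)"
proof (rule power2_le_imp_le)
  have "(norm (gradient (J k) (block x k) - gradient (J k) (block y k)))\<^sup>2
      \<le> \<delta>\<^sup>2 * (norm (block x k - block y k))\<^sup>2" for k
    using assms[of k] unfolding smooth_fun_def power_mult_distrib[symmetric] by (intro power_mono) auto
  then show "(norm (network_gradient J x - network_gradient J y))\<^sup>2 \<le> (\<delta> * norm (x - y))\<^sup>2"
    unfolding power_mult_distrib power2_norm_eq_sum_block sum_distrib_left block_diff
      block_network_gradient by (intro sum_mono)
  \<comment> \<open>Any index serves here: positivity of \<delta> is part of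
    \<open>smooth_fun\<close>.\<close>
  show "0 \<le> \<delta> * norm (x - y)" using assms[of undefined] by (simp add: smooth_fun_def)
qed

lemma network_gradient_monotone:
  assumes "\<And>k. convex_on UNIV (J k)" "\<And>k. smooth_fun \<delta> (J k)"
  shows "0 \<le> (x - y) \<bullet> (network_gradient J x - network_gradient J y)"
  using network_cost_above_gradient[where J = J, OF assms, of x y] network_cost_above_gradient[where J = J, OF assms, of y x]
  by (simp add: inner_diff_left inner_diff_right)

lemma augmented_gradient_lipschitz:
  assumes "\<And>k. smooth_fun \<delta> (J k)" and \<rho>: "0 \<le> \<rho>" and sym: "transpose B = B"
  shows "norm ((network_gradient J x + \<rho> *\<^sub>R (B *v (B *v x))) -
      (network_gradient J y + \<rho> *\<^sub>R (B *v (B *v y)))) \<le> (\<delta> + \<rho> * (sigma_max B)\<^sup>2) * norm (x - y)"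
proof -
  have le: "norm (B *v z) \<le> \<bar>sigma_max B\<bar> * norm z" for z
    by (rule power2_le_imp_le) (simp_all add: power_mult_distrib norm_matrix_le_sigma_max)
  have "norm (B *v (B *v (x - y))) \<le> \<bar>sigma_max B\<bar> * (\<bar>sigma_max B\<bar> * norm (x - y))"
    using le[of "B *v (x - y)"] mult_left_mono[OF le[of "x - y"], of "\<bar>sigma_max B\<bar>"] by simp
  then have "norm (B *v (B *v (x - y))) \<le> (sigma_max B)\<^sup>2 * norm (x - y)"
    by (simp only: mult.assoc[symmetric] abs_mult_self_eq power2_eq_square)
  then have 1: "norm (\<rho> *\<^sub>R (B *v (B *v (x - y)))) \<le> \<rho> * ((sigma_max B)\<^sup>2 * norm (x - y))"
    using \<rho> by (simp add: mult_left_mono)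
  have eq: "(network_gradient J x + \<rho> *\<^sub>R (B *v (B *v x))) - (network_gradient J y + \<rho> *\<^sub>R (B *v (B *v y)))
      = (network_gradient J x - network_gradient J y) + \<rho> *\<^sub>R (B *v (B *v (x - y)))"
    by (simp add: matrix_vector_mult_diff_distrib scaleR_diff_right)
  show ?thesis
    using norm_triangle_le[OF add_mono[OF network_gradient_lipschitz[where J = J, OF assms(1), of x y] 1]]
    by (simp only: eq distrib_right mult.assoc)
qed

section \<open>The kernel of the coupling matrix\<close>

text \<open>The factor \<open>mat 1\<close> leaves the second index alone, so kernel questions can
  be settled separately for each coordinate \<open>j\<close>, across all agents.\<close>

lemma kronecker_mat_1_mult:
  "(kronecker S (mat 1) *v x) $ (k, j) = (S *v (\<chi> l. x $ (l, j))) $ k"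
proof -
  have "(kronecker S (mat 1) *v x) $ (k, j)
      = (\<Sum>l\<in>UNIV. \<Sum>i\<in>UNIV. S $ k $ l * (if j = i then 1 else 0) * x $ (l, i))"
    unfolding matrix_vector_mult_def kronecker_def UNIV_Times_UNIV[symmetric]
    by (simp add: sum.cartesian_product split_def mat_def)
  also have "\<dots> = (\<Sum>l\<in>UNIV. \<Sum>i\<in>UNIV. if i = j then S $ k $ l * x $ (l, j) else 0)"
    by (intro sum.cong) auto
  finally show ?thesis by (simp add: matrix_vector_mult_def)
qed

lemma transpose_kronecker: "transpose (kronecker S T) = kronecker (transpose S) (transpose T)"
  by (simp add: kronecker_def transpose_def vec_eq_iff)

lemma matrix_mult_fixpoint_power:
  assumes "A *v x = x"
  shows "mat_power A p *v x = x"
  using assms by (induction p) (simp_all add: mat_power_def matrix_vector_mul_assoc[symmetric])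

text \<open>Each product of two entries of \<open>x\<close> is at most the mean of their squares;
  weighting by \<open>A\<close> and using unit row and column sums bounds
  \<open>x \<bullet> (A *v x)\<close> by \<open>x \<bullet> x\<close>.\<close>

lemma pos_semidef_mat_1_minus:
  fixes A :: "real^'k^'k"
  assumes A_sym: "transpose A = A" and A: "doubly_stochastic A"
  shows "pos_semidef (mat 1 - A)"
  unfolding pos_semidef_def
proof (intro conjI allI)
  show "transpose (mat 1 - A) = mat 1 - A"
    using A_sym by (simp add: transpose_def mat_def vec_eq_iff)
  fix x
  have row: "(\<Sum>j\<in>UNIV. A $ i $ j * t) = t" and column: "(\<Sum>j\<in>UNIV. A $ j $ i * t) = t" for i t
    using A by (simp_all add: doubly_stochastic_def sum_distrib_right[symmetric])
  have "x \<bullet> (A *v x) = (\<Sum>i\<in>UNIV. \<Sum>j\<in>UNIV. A $ i $ j * (x $ i * x $ j))"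
    by (simp add: inner_vec_def matrix_vector_mult_def sum_distrib_left mult_ac)
  also have "\<dots> \<le> (\<Sum>i\<in>UNIV. \<Sum>j\<in>UNIV. A $ i $ j * ((x $ i)\<^sup>2 / 2 + (x $ j)\<^sup>2 / 2))"
  proof (intro sum_mono mult_left_mono)
    fix i j
    show "x $ i * x $ j \<le> (x $ i)\<^sup>2 / 2 + (x $ j)\<^sup>2 / 2"
      using sum_squares_bound[of "x $ i" "x $ j"] by simp
    show "0 \<le> A $ i $ j" using A by (simp add: doubly_stochastic_def)
  qed
  also have "\<dots> = (\<Sum>i\<in>UNIV. \<Sum>j\<in>UNIV. A $ i $ j * ((x $ i)\<^sup>2 / 2))
      + (\<Sum>j\<in>UNIV. \<Sum>i\<in>UNIV. A $ i $ j * ((x $ j)\<^sup>2 / 2))"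
    by (subst (3) sum.swap) (simp add: distrib_left sum.distrib)
  also have "(\<Sum>i\<in>UNIV. \<Sum>j\<in>UNIV. A $ i $ j * ((x $ i)\<^sup>2 / 2)) = (\<Sum>i\<in>UNIV. (x $ i)\<^sup>2 / 2)"
    by (simp only: row)
  also have "(\<Sum>j\<in>UNIV. \<Sum>i\<in>UNIV. A $ i $ j * ((x $ j)\<^sup>2 / 2)) = (\<Sum>j\<in>UNIV. (x $ j)\<^sup>2 / 2)"
    by (simp only: column)
  also have "(\<Sum>i\<in>UNIV. (x $ i)\<^sup>2 / 2) + (\<Sum>j\<in>UNIV. (x $ j)\<^sup>2 / 2) = x \<bullet> x"
    by (simp add: inner_vec_def sum.distrib[symmetric] power2_eq_square)
  finally show "0 \<le> x \<bullet> ((mat 1 - A) *v x)"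
    by (simp add: matrix_vector_mult_diff_rdistrib inner_diff_right)
qed

text \<open>Evaluate \<open>A\<^sup>p x = x\<close> at a maximal entry of \<open>x\<close>: a strictly positive average
  attains the maximum only if all entries agree.\<close>

lemma primitive_fixpoint_constant:
  fixes A :: "real^'k^'k"
  assumes A: "doubly_stochastic A" and prim: "primitive_matrix A" and x: "A *v x = x"
  shows "x $ i = x $ j"
proof -
  obtain p where P_pos: "\<And>i j. 0 < mat_power A p $ i $ j"
    using prim by (auto simp: primitive_matrix_def)
  define P where "P = mat_power A p"
  have "A *v (\<chi> _. 1) = (\<chi> _. 1)"
    using A by (simp add: doubly_stochastic_def matrix_vector_mult_def)
  then have "P *v (\<chi> _. 1) = (\<chi> _. 1)" unfolding P_def by (rule matrix_mult_fixpoint_power)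
  then have row: "(\<Sum>j\<in>UNIV. P $ i $ j) = 1" for i
    by (simp add: matrix_vector_mult_def vec_eq_iff)
  have Px: "P *v x = x" unfolding P_def by (rule matrix_mult_fixpoint_power[OF x])
  have "Max (range (\<lambda>j. x $ j)) \<in> range (\<lambda>j. x $ j)" by (rule Max_in) auto
  then obtain m where max: "Max (range (\<lambda>j. x $ j)) = x $ m" by (rule imageE)
  have m: "x $ j \<le> x $ m" for j
    using Max_ge[of "range (\<lambda>j. x $ j)" "x $ j"] by (simp add: max)
  have "(\<Sum>j\<in>UNIV. P $ m $ j * (x $ m - x $ j)) = x $ m - (P *v x) $ m"
    by (simp add: right_diff_distrib sum_subtractf sum_distrib_right[symmetric] row
        matrix_vector_mult_def)
  then have "(\<Sum>j\<in>UNIV. P $ m $ j * (x $ m - x $ j)) = 0" by (simp add: Px)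
  moreover have "0 \<le> P $ m $ j * (x $ m - x $ j)" for j
    using P_pos[of m j] m[of j] by (simp add: P_def)
  ultimately have "P $ m $ j * (x $ m - x $ j) = 0" for j
    by (simp add: sum_nonneg_eq_0_iff)
  then have "x $ j = x $ m" for j
    using P_pos[of m j] unfolding P_def[symmetric]
    by (metis less_irrefl mult_eq_0_iff right_minus_eq)
  then show ?thesis by metis
qed

text \<open>The square root has the same kernel as its square \<open>mat 1 - A\<close>, namely the
  fixed vectors of \<open>A\<close>; these are constant by primitivity, and this holds for every
  coordinate \<open>j\<close>.\<close>

lemma kernel_consensus:
  fixes A :: "real^'k^'k" and x :: "real^('k \<times> 'm::finite)"
  assumes A_sym: "transpose A = A" and A: "doubly_stochastic A" and prim: "primitive_matrix A"
  shows "kronecker (psd_sqrt (mat 1 - A)) (mat 1) *v x = 0 \<longleftrightarrow> (\<exists>u. x = col (\<lambda>_. u))"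
proof -
  define S where "S = psd_sqrt (mat 1 - A)"
  have S: "pos_semidef S" "S ** S = mat 1 - A"
    using psd_sqrt[OF pos_semidef_mat_1_minus[OF A_sym A]] by (auto simp: S_def)
  have ker: "S *v z = 0 \<longleftrightarrow> A *v z = z" for z
  proof
    assume "S *v z = 0"
    then have "(S ** S) *v z = 0" by (simp add: matrix_vector_mul_assoc[symmetric])
    then show "A *v z = z" by (simp add: S(2) matrix_vector_mult_diff_rdistrib)
  next
    assume "A *v z = z"
    then have "(S ** S) *v z = 0\<^sup>2 *\<^sub>R z" by (simp add: S(2) matrix_vector_mult_diff_rdistrib)
    then show "S *v z = 0" using pos_semidef_sqrt_eigenvector[OF S(1), of 0 z] by simp
  qed
  have "kronecker S (mat 1) *v x = 0 \<longleftrightarrow> (\<forall>j. S *v (\<chi> l. x $ (l, j)) = 0)"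
    by (simp add: vec_eq_iff[of "_ *v _"] kronecker_mat_1_mult split_paired_all) (auto simp: vec_eq_iff)
  also have "\<dots> \<longleftrightarrow> (\<forall>j. A *v (\<chi> l. x $ (l, j)) = (\<chi> l. x $ (l, j)))"
    by (simp add: ker)
  also have "\<dots> \<longleftrightarrow> (\<exists>u. x = col (\<lambda>_. u))"
  proof
    assume fixed: "\<forall>j. A *v (\<chi> l. x $ (l, j)) = (\<chi> l. x $ (l, j))"
    define k :: 'k where "k = undefined"
    have "x $ (i, j) = x $ (k, j)" for i j
      using primitive_fixpoint_constant[OF A prim fixed[rule_format, of j], of i k] by simp
    then have "x = col (\<lambda>_. \<chi> j. x $ (k, j))" by (simp add: col_def vec_eq_iff split_paired_all)
    then show "\<exists>u. x = col (\<lambda>_. u)" ..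
  next
    assume "\<exists>u. x = col (\<lambda>_. u)"
    then show "\<forall>j. A *v (\<chi> l. x $ (l, j)) = (\<chi> l. x $ (l, j))"
      using A by (auto simp: col_def doubly_stochastic_def matrix_vector_mult_def vec_eq_iff
          sum_distrib_right[symmetric])
  qed
  finally show ?thesis by (simp add: S_def)
qed

text \<open>With two distinct agents, a vector supported on one block is not a consensus vector.
  That \<open>B\<close> is non-zero makes its extreme singular values meaningful and
  positive.\<close>

lemma consensus_kernel_imp_nonzero:
  fixes B :: "real^('k::finite \<times> 'm::finite)^('k \<times> 'm)"
  assumes K: "2 \<le> CARD('k)" and ker: "\<And>x. B *v x = 0 \<longleftrightarrow> (\<exists>u. x = col (\<lambda>_. u))"
  shows "B \<noteq> 0"
proof
  assume "B = 0"
  obtain i j :: 'k where ij: "i \<noteq> j" using K card_le_Suc0_iff_eq[of "UNIV :: 'k set"] by auto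
  let ?x = "col (\<lambda>k. if k = i then 1 else 0) :: real^('k \<times> 'm)"
  have "B *v ?x = 0" using \<open>B = 0\<close> by simp
  then obtain u where "?x = col (\<lambda>_. u)" using ker by blast
  then have "block ?x i = block ?x j" by simp
  then show False using ij by simp
qed

section \<open>Primal and dual optimality\<close>

text \<open>A symmetric \<open>B\<close> and \<open>B ** B\<close> have the same kernel, so
  \<open>g\<close> lies in the range of \<open>B ** B\<close>; the second factor puts the multiplier
  itself into the range of \<open>B\<close>. Uniqueness holds because range and kernel meet only in
  0.\<close>

lemma dual_solution_unique:
  fixes B :: "real^'n^'n"
  assumes sym: "transpose B = B" and g: "\<And>z. B *v z = 0 \<Longrightarrow> z \<bullet> g = 0"
  shows "\<exists>!l. l \<in> range (\<lambda>x. B *v x) \<and> g + B *v l = 0"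
proof -
  have inner: "x \<bullet> (B *v y) = (B *v x) \<bullet> y" for x y
    using sym transpose_eq_self_iff by blast
  have BB: "B *v z = 0" if "B *v (B *v z) = 0" for z
    using inner[of z "B *v z"] that by simp
  have "transpose (B ** B) = B ** B" by (simp add: matrix_transpose_mul sym)
  moreover have "z \<bullet> g = 0" if "(B ** B) *v z = 0" for z
    using that g BB by (simp add: matrix_vector_mul_assoc[symmetric])
  ultimately have "g \<in> range (\<lambda>z. (B ** B) *v z)"
    by (rule symmetric_range_eq_kernel_complement)
  then obtain t where t: "g = B *v (B *v t)" by (auto simp: matrix_vector_mul_assoc[symmetric])
  show ?thesis
  proof (rule ex1I)
    have "B *v (- t) = - (B *v t)" for t by (rule linear_neg[OF matrix_vector_mul_linear])
    then show "B *v (- t) \<in> range (\<lambda>x. B *v x) \<and> g + B *v (B *v (- t)) = 0"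
      unfolding t by (metis add.right_inverse rangeI)
    fix l assume l: "l \<in> range (\<lambda>x. B *v x) \<and> g + B *v l = 0"
    then obtain r where r: "l = B *v r" by blast
    have "B *v (B *v (r + t)) = 0" using l r t by (simp add: matrix_vector_right_distrib add.commute)
    then have "B *v (r + t) = 0" by (rule BB)
    then have "B *v r = - (B *v t)" by (simp add: matrix_vector_right_distrib eq_neg_iff_add_eq_0)
    then show "l = B *v (- t)" using r linear_neg[OF matrix_vector_mul_linear, of B t] by simp
  qed
qed

lemma gradient_aggregate_cost:
  fixes J :: "'k::finite \<Rightarrow> real^'m \<Rightarrow> real"
  assumes "\<And>k. smooth_fun \<delta> (J k)"
  shows "gradient (aggregate_cost J) v = (1 / real CARD('k)) *\<^sub>R (\<Sum>k\<in>UNIV. gradient (J k) v)"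
  by (rule gradient_eq[OF gderiv_aggregate_cost[where J = J, OF assms]])

lemma inner_gradient_aggregate_cost_diff:
  fixes J :: "'k::finite \<Rightarrow> real^'m \<Rightarrow> real"
  assumes "\<And>k. smooth_fun \<delta> (J k)"
  shows "real CARD('k) * (u \<bullet> (gradient (aggregate_cost J) x - gradient (aggregate_cost J) y)) =
    (\<Sum>k\<in>UNIV. u \<bullet> (gradient (J k) x - gradient (J k) y))"
  by (simp add: gradient_aggregate_cost[where J = J, OF assms] inner_diff_right inner_sum_right
      sum_subtractf right_diff_distrib)

text \<open>\<open>ARG_MIN\<close> is informative only if a minimum is attained. The contraction
  argument provides a zero \<open>x0\<close> of the gradient, convexity makes it a global minimizer,
  and equality of values makes the selected point a minimizer too, hence stationary.\<close>

lemma aggregate_cost_minimizer_stationary: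
  fixes J :: "'k::finite \<Rightarrow> real^'m \<Rightarrow> real"
  assumes conv: "\<And>k. convex_on UNIV (J k)" and smooth: "\<And>k. smooth_fun \<delta> (J k)"
    and strong: "strongly_convex_fun \<beta> (aggregate_cost J)"
  shows "(\<Sum>k\<in>UNIV. gradient (J k) (ARG_MIN (aggregate_cost J) v. True)) = 0"
proof -
  let ?f = "aggregate_cost J" and ?K = "real CARD('k)"
  let ?g = "gradient ?f"
  note g = gradient_aggregate_cost[of \<delta> J, OF smooth]
  have lip: "norm (?g x - ?g y) \<le> \<delta> * norm (x - y)" for x y
  proof -
    have "norm (\<Sum>k\<in>UNIV. gradient (J k) x - gradient (J k) y) \<le> (\<Sum>k\<in>(UNIV :: 'k set). \<delta> * norm (x - y))"
      by (rule sum_norm_le) (use smooth in \<open>simp add: smooth_fun_def\<close>)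
    then have "norm (\<Sum>k\<in>UNIV. gradient (J k) x - gradient (J k) y) \<le> ?K * (\<delta> * norm (x - y))"
      by simp
    then show ?thesis
      by (simp add: g scaleR_diff_right[symmetric] sum_subtractf[symmetric] field_simps)
  qed
  obtain x0 where x0: "?g x0 = 0"
    using strongly_monotone_lipschitz_zero[OF _ lip, of \<beta>] strong smooth
    by (auto simp: strongly_convex_fun_def smooth_fun_def)
  have "?f x0 \<le> ?f y" for y
  proof -
    have "(\<Sum>k\<in>UNIV. J k x0 + (y - x0) \<bullet> gradient (J k) x0) \<le> (\<Sum>k\<in>UNIV. J k y)"
      by (intro sum_mono convex_on_imp_above_gradient conv smooth_fun_gderiv[OF smooth])
    moreover have "(\<Sum>k\<in>UNIV. gradient (J k) x0) = 0" using x0 by (simp add: g)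
    ultimately have "(\<Sum>k\<in>UNIV. J k x0) \<le> (\<Sum>k\<in>UNIV. J k y)"
      by (simp add: sum.distrib inner_sum_right[symmetric])
    then show ?thesis by (simp add: aggregate_cost_def divide_right_mono)
  qed
  moreover from this have "?f (ARG_MIN ?f v. True) = ?f x0" by (simp add: arg_min_equality)
  ultimately have "\<forall>y. ?f (ARG_MIN ?f v. True) \<le> ?f y" by simp
  moreover have "(?f has_derivative (\<lambda>h. h \<bullet> ?g v)) (at v)" for v
    using gderiv_aggregate_cost[where J = J, OF smooth, of v] unfolding gderiv_def g .
  ultimately have "(\<lambda>h. h \<bullet> ?g (ARG_MIN ?f v. True)) = (\<lambda>_. 0)"
    by (intro differential_zero_maxmin[OF UNIV_I open_UNIV]) blast+
  then have "?g (ARG_MIN ?f v. True) \<bullet> ?g (ARG_MIN ?f v. True) = 0" by (rule fun_cong)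
  then show ?thesis by (simp add: g)
qed

text \<open>For the case without penalty: it makes the stationarity result for the aggregate
  minimizer available there as well.\<close>

lemma strongly_convex_aggregate_cost:
  fixes J :: "'k::finite \<Rightarrow> real^'m \<Rightarrow> real"
  assumes smooth: "\<And>k. smooth_fun \<delta> (J k)" and strong: "\<And>k. strongly_convex_fun (\<beta> k) (J k)"
  shows "strongly_convex_fun (Min (range \<beta>)) (aggregate_cost J)"
proof -
  have "aggregate_cost J differentiable_on UNIV"
    using gderiv_aggregate_cost[where J = J, OF smooth] unfolding gderiv_def
    by (metis differentiableI differentiable_at_imp_differentiable_on)
  moreover have "Min (range \<beta>) * (norm (x - y))\<^sup>2
      \<le> (x - y) \<bullet> (gradient (aggregate_cost J) x - gradient (aggregate_cost J) y)" for x y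
  proof -
    have "(\<Sum>k\<in>(UNIV :: 'k set). Min (range \<beta>) * (norm (x - y))\<^sup>2)
        \<le> (\<Sum>k\<in>UNIV. (x - y) \<bullet> (gradient (J k) x - gradient (J k) y))"
    proof (rule sum_mono)
      fix k
      have "Min (range \<beta>) * (norm (x - y))\<^sup>2 \<le> \<beta> k * (norm (x - y))\<^sup>2"
        by (intro mult_right_mono) auto
      also have "\<dots> \<le> (x - y) \<bullet> (gradient (J k) x - gradient (J k) y)"
        using strong[of k] by (simp add: strongly_convex_fun_def)
      finally show "Min (range \<beta>) * (norm (x - y))\<^sup>2 \<le> (x - y) \<bullet> (gradient (J k) x - gradient (J k) y)" .
    qed
    then have "real CARD('k) * (Min (range \<beta>) * (norm (x - y))\<^sup>2) \<le>
        real CARD('k) * ((x - y) \<bullet> (gradient (aggregate_cost J) x - gradient (aggregate_cost J) y))"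
      unfolding inner_gradient_aggregate_cost_diff[where J = J, OF smooth] by simp
    then show ?thesis by (simp only: mult_le_cancel_left_pos of_nat_0_less_iff zero_less_card_finite)
  qed
  moreover have "0 < Min (range \<beta>)"
    using strong by (auto simp: strongly_convex_fun_def)
  ultimately show ?thesis by (simp add: strongly_convex_fun_def)
qed

section \<open>Strong monotonicity towards a consensus vector\<close>

lemma network_gradient_strongly_monotone:
  fixes J :: "'k::finite \<Rightarrow> real^'m \<Rightarrow> real"
  assumes strong: "\<And>k. strongly_convex_fun (\<beta> k) (J k)"
  shows "Min (range \<beta>) * (norm (x - y))\<^sup>2 \<le> (x - y) \<bullet> (network_gradient J x - network_gradient J y)"
  unfolding inner_eq_sum_block power2_norm_eq_sum_block block_diff block_network_gradient sum_distrib_left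
proof (rule sum_mono)
  fix k
  have "Min (range \<beta>) * (norm (block x k - block y k))\<^sup>2 \<le> \<beta> k * (norm (block x k - block y k))\<^sup>2"
    by (intro mult_right_mono) auto
  also have "\<dots> \<le> (block x k - block y k) \<bullet> (gradient (J k) (block x k) - gradient (J k) (block y k))"
    using strong[of k] by (simp add: strongly_convex_fun_def)
  finally show "Min (range \<beta>) * (norm (block x k - block y k))\<^sup>2
    \<le> (block x k - block y k) \<bullet> (gradient (J k) (block x k) - gradient (J k) (block y k))" .
qed

text \<open>\<open>U\<close> and \<open>V\<close> are the norms of the consensus component and of
  the remainder, \<open>p\<close> the gradient term and \<open>q\<close> the penalty. If
  \<open>V\<close> is at most \<open>\<eta> * U\<close>, the cross term costs at most 2 \<delta>
  \<eta> U^2 and the penalty covers V^2.\<close>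

lemma penalty_case_distinction:
  fixes U V :: real
  assumes UV: "0 \<le> U" "0 \<le> V" and \<eta>: "0 < \<eta>" and r: "0 \<le> r" and \<delta>: "0 \<le> \<delta>"
    and \<nu>: "\<nu> \<le> \<beta> - 2 * \<delta> * \<eta>" "\<nu> \<le> r * \<eta>\<^sup>2 / (4 * (\<eta>\<^sup>2 + 1))"
    and p: "0 \<le> p" "\<beta> * U\<^sup>2 - 2 * \<delta> * U * V \<le> p" and q: "r * V\<^sup>2 \<le> q"
  shows "\<nu> * (U\<^sup>2 + V\<^sup>2) \<le> p + q"
proof -
  have pos: "0 < 4 * (\<eta>\<^sup>2 + 1)" by (simp add: add_nonneg_pos)
  have \<nu>r: "\<nu> * (4 * (\<eta>\<^sup>2 + 1)) \<le> r * \<eta>\<^sup>2" using \<nu>(2) pos by (simp only: pos_le_divide_eq)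
  show ?thesis
  proof (cases "V \<le> \<eta> * U")
    case True
    have "r * \<eta>\<^sup>2 \<le> r * (4 * (\<eta>\<^sup>2 + 1))" using r by (intro mult_left_mono) auto
    then have "\<nu> \<le> r" using \<nu>r pos by (meson mult_le_cancel_right_pos order_trans)
    then have "\<nu> * V\<^sup>2 \<le> r * V\<^sup>2" by (intro mult_right_mono) auto
    moreover have "\<nu> * U\<^sup>2 \<le> (\<beta> - 2 * \<delta> * \<eta>) * U\<^sup>2" using \<nu>(1) by (intro mult_right_mono) auto
    moreover have "2 * \<delta> * U * V \<le> 2 * \<delta> * U * (\<eta> * U)" using True UV \<delta> by (intro mult_left_mono) auto
    ultimately show ?thesis using p q by (simp add: power2_eq_square algebra_simps)
  next
    case False
    \<comment> \<open>Now U^2 is at most V^2 / \<eta>^2, so the penalty alone pays for both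
      components and only \<open>0 \<le> p\<close> is used of the gradient term.\<close>
    then have "(\<eta> * U)\<^sup>2 \<le> V\<^sup>2" using UV \<eta> by (intro power_mono) auto
    then have "\<eta>\<^sup>2 * (U\<^sup>2 + V\<^sup>2) \<le> V\<^sup>2 + \<eta>\<^sup>2 * V\<^sup>2"
      by (simp add: power_mult_distrib algebra_simps)
    also have "\<dots> \<le> 4 * (V\<^sup>2 + \<eta>\<^sup>2 * V\<^sup>2)"
      using mult_right_mono[of 1 4 "V\<^sup>2 + \<eta>\<^sup>2 * V\<^sup>2"] by (simp del: distrib_left_numeral)
    also have "\<dots> = (4 * (\<eta>\<^sup>2 + 1)) * V\<^sup>2" by (simp add: algebra_simps)
    finally have "\<eta>\<^sup>2 * (U\<^sup>2 + V\<^sup>2) \<le> (4 * (\<eta>\<^sup>2 + 1)) * V\<^sup>2" .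
    then have "r * (\<eta>\<^sup>2 * (U\<^sup>2 + V\<^sup>2)) \<le> r * ((4 * (\<eta>\<^sup>2 + 1)) * V\<^sup>2)" using r by (rule mult_left_mono)
    moreover have "\<nu> * (4 * (\<eta>\<^sup>2 + 1)) * (U\<^sup>2 + V\<^sup>2) \<le> r * \<eta>\<^sup>2 * (U\<^sup>2 + V\<^sup>2)"
      using \<nu>r by (intro mult_right_mono) auto
    ultimately have "(4 * (\<eta>\<^sup>2 + 1)) * (\<nu> * (U\<^sup>2 + V\<^sup>2)) \<le> (4 * (\<eta>\<^sup>2 + 1)) * (r * V\<^sup>2)"
      by (simp only: mult_ac)
    then have "\<nu> * (U\<^sup>2 + V\<^sup>2) \<le> r * V\<^sup>2" using pos by (simp only: mult_le_cancel_left_pos)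
    then show ?thesis using p q by linarith
  qed
qed

text \<open>The consensus point \<open>?s + c\<close> is inserted between \<open>x\<close> and
  \<open>?s\<close>. Of the four resulting products, the one along \<open>c\<close> between
  consensus points is controlled by the aggregate, the one along \<open>v\<close> from
  \<open>?s + c\<close> to \<open>x\<close> by monotonicity, and the two mixed ones by the Lipschitz
  bound.\<close>

lemma augmented_gradient_restricted_monotone:
  fixes J :: "'k::finite \<Rightarrow> real^'m \<Rightarrow> real" and B :: "real^('k \<times> 'm)^('k \<times> 'm)"
  assumes conv: "\<And>k. convex_on UNIV (J k)" and smooth: "\<And>k. smooth_fun \<delta> (J k)"
    and strong: "strongly_convex_fun \<beta> (aggregate_cost J)"
    and ker: "\<And>x. B *v x = 0 \<longleftrightarrow> (\<exists>u. x = col (\<lambda>_. u))"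
    and \<rho>: "0 \<le> \<rho>" and \<eta>: "0 < \<eta>" and \<nu>: "\<nu> \<le> \<beta> - 2 * \<delta> * \<eta>"
      "\<nu> \<le> \<rho> * (sigma_min_nz B)\<^sup>2 * \<eta>\<^sup>2 / (4 * (\<eta>\<^sup>2 + 1))"
  shows "\<nu> * (norm (x - col (\<lambda>_. a)))\<^sup>2 \<le>
    (x - col (\<lambda>_. a)) \<bullet> (network_gradient J x - network_gradient J (col (\<lambda>_. a)))
      + \<rho> * (norm (B *v (x - col (\<lambda>_. a))))\<^sup>2"
proof -
  let ?N = "network_gradient J" and ?K = "real CARD('k)" and ?s = "col (\<lambda>_. a)"
  define e where "e = x - ?s"
  define u where "u = (1 / ?K) *\<^sub>R (\<Sum>k\<in>UNIV. block e k)"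
  define c :: "real^('k \<times> 'm)" where "c = col (\<lambda>_. u)"
  define v where "v = e - c"
  have \<delta>: "0 < \<delta>" using smooth by (simp add: smooth_fun_def)
  \<comment> \<open>Subtracting the block average makes \<open>v\<close> orthogonal to all consensus
    vectors, that is to the kernel of \<open>B\<close>, as the lower singular value bound
    requires.\<close>
  have v_orth: "col (\<lambda>_. z) \<bullet> v = 0" for z
  proof -
    have "col (\<lambda>_. z) \<bullet> v = z \<bullet> ((\<Sum>k\<in>UNIV. block e k) - ?K *\<^sub>R u)"
      by (simp add: inner_eq_sum_block v_def c_def block_diff sum_subtractf inner_sum_right
          inner_diff_right sum_constant_scaleR)
    then show ?thesis by (simp add: u_def)
  qed
  have e: "e = c + v" by (simp add: v_def)
  have norm_e: "(norm e)\<^sup>2 = (norm c)\<^sup>2 + (norm v)\<^sup>2"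
    using v_orth[of u] unfolding e power2_norm_eq_inner
    by (simp add: c_def inner_add_left inner_add_right inner_commute)
  have "B *v c = 0" using ker c_def by blast
  then have Be: "B *v e = B *v v" by (simp add: e matrix_vector_right_distrib)
  have "(sigma_min_nz B)\<^sup>2 * (norm v)\<^sup>2 \<le> (norm (B *v v))\<^sup>2"
    by (rule norm_matrix_ge_sigma_min_nz) (use ker v_orth in auto)
  then have penalty: "\<rho> * (sigma_min_nz B)\<^sup>2 * (norm v)\<^sup>2 \<le> \<rho> * (norm (B *v e))\<^sup>2"
    unfolding Be using \<rho> by (simp add: mult.assoc mult_left_mono)
  have x: "x = ?s + c + v" by (simp add: e[symmetric] e_def add.assoc)
  have sc: "?s + c = col (\<lambda>_. a + u)" by (simp add: c_def col_def vec_eq_iff)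
  have cross: "norm (?N x - ?N (?s + c)) \<le> \<delta> * norm v" "norm (?N (?s + c) - ?N ?s) \<le> \<delta> * norm c"
    using network_gradient_lipschitz[where J = J, OF smooth, of x "?s + c"]
      network_gradient_lipschitz[where J = J, OF smooth, of "?s + c" ?s] by (simp_all add: x)
  \<comment> \<open>The number of agents cancels: it relates both the norm of \<open>c\<close> to
    that of \<open>u\<close> and the sum of the gradients to the aggregate gradient.\<close>
  have cc: "\<beta> * (norm c)\<^sup>2 \<le> c \<bullet> (?N (?s + c) - ?N ?s)"
  proof -
    have "\<beta> * (norm u)\<^sup>2 \<le> u \<bullet> (gradient (aggregate_cost J) (a + u) - gradient (aggregate_cost J) a)"
      using strong unfolding strongly_convex_fun_def by (metis add_diff_cancel_left')
    then have "?K * (\<beta> * (norm u)\<^sup>2) \<le>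
        ?K * (u \<bullet> (gradient (aggregate_cost J) (a + u) - gradient (aggregate_cost J) a))"
      by (rule mult_left_mono) simp
    then have "?K * (\<beta> * (norm u)\<^sup>2) \<le> (\<Sum>k\<in>UNIV. u \<bullet> (gradient (J k) (a + u) - gradient (J k) a))"
      unfolding inner_gradient_aggregate_cost_diff[where J = J, OF smooth] .
    moreover have "(norm c)\<^sup>2 = ?K * (norm u)\<^sup>2" by (simp add: c_def power2_norm_eq_sum_block)
    moreover have "c \<bullet> (?N (?s + c) - ?N ?s) = (\<Sum>k\<in>UNIV. u \<bullet> (gradient (J k) (a + u) - gradient (J k) a))"
      unfolding sc by (simp add: c_def inner_eq_sum_block block_diff)
    ultimately show ?thesis by (simp add: mult.left_commute)
  qed
  have cv: "- (\<delta> * norm c * norm v) \<le> c \<bullet> (?N x - ?N (?s + c))"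
    using Cauchy_Schwarz_ineq2[of c "?N x - ?N (?s + c)"]
      mult_left_mono[OF cross(1), of "norm c"] by (simp add: mult_ac)
  have vc: "- (\<delta> * norm c * norm v) \<le> v \<bullet> (?N (?s + c) - ?N ?s)"
    using Cauchy_Schwarz_ineq2[of v "?N (?s + c) - ?N ?s"]
      mult_left_mono[OF cross(2), of "norm v"] by (simp add: mult_ac)
  have vv: "0 \<le> v \<bullet> (?N x - ?N (?s + c))"
    using network_gradient_monotone[where J = J, OF conv smooth, of x "?s + c"] by (simp add: x)
  have "e \<bullet> (?N x - ?N ?s) = c \<bullet> (?N (?s + c) - ?N ?s) + c \<bullet> (?N x - ?N (?s + c))
      + v \<bullet> (?N (?s + c) - ?N ?s) + v \<bullet> (?N x - ?N (?s + c))"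
    by (simp add: e inner_add_left inner_diff_right)
  then have lower: "\<beta> * (norm c)\<^sup>2 - 2 * \<delta> * norm c * norm v \<le> e \<bullet> (?N x - ?N ?s)"
    using cc cv vc vv by simp
  have "0 \<le> e \<bullet> (?N x - ?N ?s)"
    using network_gradient_monotone[where J = J, OF conv smooth, of x ?s] by (simp add: e_def)
  then show ?thesis unfolding e_def[symmetric] norm_e
    using penalty_case_distinction[OF _ _ \<eta> _ _ \<nu>(1) _ _ lower penalty] \<nu>(2) \<rho> \<delta> by simp
qed

section \<open>Convergence rates with and without penalty\<close>

theorem corollary2:
  fixes J :: "'k::finite \<Rightarrow> real^'m \<Rightarrow> real"
    and A :: "real^'k^'k"
    and B :: "real^('k \<times> 'm)^('k \<times> 'm)"
    and \<delta> \<rho> \<mu>\<^sub>w \<mu>\<^sub>l :: real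
    and w y :: "int \<Rightarrow> real^('k \<times> 'm)"
    and w_star :: "real^'m"
    and ws_star lb_star :: "real^('k \<times> 'm)"
  assumes K: "2 \<le> CARD('k)"
    and J_convex: "\<And>k. convex_on UNIV (J k)"
    and J_smooth: "\<And>k. smooth_fun \<delta> (J k)"
    and A_sym: "transpose A = A"
    and A_stoch: "doubly_stochastic A"
    and A_prim: "primitive_matrix A"
    and B_eq: "B = kronecker (psd_sqrt (mat 1 - A)) (mat 1)"
    and rho: "0 \<le> \<rho>"
    and mu_w: "0 < \<mu>\<^sub>w"
    and mu_lambda: "0 < \<mu>\<^sub>l"
    and y_init: "y (-1) = 0"
    and w_rec: "\<And>i. 0 \<le> i \<Longrightarrow>
      w i = w (i - 1) - \<mu>\<^sub>w *\<^sub>R gradient (augmented_cost J B \<rho>) (w (i - 1)) - \<mu>\<^sub>w *\<^sub>R y (i - 1)"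
    and y_rec: "\<And>i. 0 \<le> i \<Longrightarrow> y i = y (i - 1) + \<mu>\<^sub>l *\<^sub>R ((B ** B) *v w i)"
    and w_star: "w_star = (ARG_MIN (aggregate_cost J) v. True)"
    and ws_star: "ws_star = col (\<lambda>k. w_star)"
    and lambda_star: "lb_star =
      (THE l. l \<in> range (\<lambda>x. B *v x) \<and> gradient (network_cost J) ws_star + B *v l = 0)"
  shows
    "(\<forall>\<beta> \<eta>. 0 < \<rho> \<longrightarrow> strongly_convex_fun \<beta> (aggregate_cost J) \<longrightarrow> 0 < \<eta> \<longrightarrow> \<eta> < \<beta> / (2 * \<delta>) \<longrightarrow>
        (let \<delta>\<^sub>\<rho> = \<delta> + \<rho> * (sigma_max B)\<^sup>2;
             \<nu>\<^sub>\<rho> = min (\<beta> - 2 * \<delta> * \<eta>) (\<rho> * (sigma_min_nz B)\<^sup>2 * \<eta>\<^sup>2 / (4 * (\<eta>\<^sup>2 + 1)))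
         in 0 < \<nu>\<^sub>\<rho> \<and>
            (\<mu>\<^sub>w < 1 / \<delta>\<^sub>\<rho> \<longrightarrow> \<mu>\<^sub>l \<le> \<nu>\<^sub>\<rho> / (sigma_max B)\<^sup>2 \<longrightarrow>
              converges_linearly w y ws_star (B *v lb_star)
                (max (1 - \<mu>\<^sub>w * \<nu>\<^sub>\<rho> * (1 - \<mu>\<^sub>w * \<delta>\<^sub>\<rho>)) (1 - \<mu>\<^sub>w * \<mu>\<^sub>l * (sigma_min_nz B)\<^sup>2)))))
     \<and> (\<forall>\<beta>::'k \<Rightarrow> real. \<rho> = 0 \<longrightarrow> (\<forall>k. strongly_convex_fun (\<beta> k) (J k)) \<longrightarrow>
        (let \<nu>\<^sub>0 = Min (range \<beta>)
         in \<mu>\<^sub>w < 1 / \<delta> \<longrightarrow> \<mu>\<^sub>l \<le> \<nu>\<^sub>0 / (sigma_max B)\<^sup>2 \<longrightarrow>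
              converges_linearly w y ws_star (B *v lb_star)
                (max (1 - \<mu>\<^sub>w * \<nu>\<^sub>0 * (1 - \<mu>\<^sub>w * \<delta>)) (1 - \<mu>\<^sub>w * \<mu>\<^sub>l * (sigma_min_nz B)\<^sup>2))))"
proof -
  have \<delta>: "0 < \<delta>" using J_smooth by (simp add: smooth_fun_def)
  have "transpose (psd_sqrt (mat 1 - A)) = psd_sqrt (mat 1 - A)"
    using psd_sqrt(1)[OF pos_semidef_mat_1_minus[OF A_sym A_stoch]] by (simp add: pos_semidef_def)
  then have B_sym: "transpose B = B" by (simp add: B_eq transpose_kronecker)
  then have B_inner: "x \<bullet> (B *v z) = (B *v x) \<bullet> z" for x z
    using transpose_eq_self_iff by blast
  have ker: "B *v x = 0 \<longleftrightarrow> (\<exists>u. x = col (\<lambda>_. u))" for x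
    unfolding B_eq by (rule kernel_consensus[OF A_sym A_stoch A_prim])
  have "B \<noteq> 0" by (rule consensus_kernel_imp_nonzero[OF K ker])
  then have sigma_min: "0 < (sigma_min_nz B)\<^sup>2" using sigma_min_nz_pos[of B] by simp
  obtain z where "B *v z \<noteq> 0" using \<open>B \<noteq> 0\<close> by (metis matrix_eq matrix_vector_mult_0)
  then have "0 < (norm (B *v z))\<^sup>2" by simp
  then have "0 < (sigma_max B)\<^sup>2 * (norm z)\<^sup>2" using norm_matrix_le_sigma_max[of B z] by linarith
  then have sigma_max: "0 < (sigma_max B)\<^sup>2" by (simp add: zero_less_mult_iff)

  define G where "G x = network_gradient J x + \<rho> *\<^sub>R (B *v (B *v x))" for x
  have gderiv_G: "GDERIV (augmented_cost J B \<rho>) x :> G x" for x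
    using gderiv_augmented_cost[where J = J, OF J_smooth, of B \<rho> x] by (simp only: G_def B_sym)
  have lip_G: "norm (G x - G z) \<le> (\<delta> + \<rho> * (sigma_max B)\<^sup>2) * norm (x - z)" for x z
    unfolding G_def by (rule augmented_gradient_lipschitz[where J = J, OF J_smooth rho B_sym])
  have tangent_G: "augmented_cost J B \<rho> x + (z - x) \<bullet> G x \<le> augmented_cost J B \<rho> z" for x z
    using augmented_cost_above_gradient[where J = J, OF J_convex J_smooth rho, of B x z] by (simp only: G_def B_sym)
  have L: "0 < \<delta> + \<rho> * (sigma_max B)\<^sup>2" using \<delta> rho by (simp add: add_pos_nonneg)
  have B_ws: "B *v ws_star = 0" unfolding ker ws_star by blast
  have G_mono: "(G x - G ws_star) \<bullet> (x - ws_star) =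
      (x - ws_star) \<bullet> (network_gradient J x - network_gradient J ws_star)
        + \<rho> * (norm (B *v (x - ws_star)))\<^sup>2" for x
  proof -
    have "G x - G ws_star = (network_gradient J x - network_gradient J ws_star)
        + \<rho> *\<^sub>R (B *v (B *v (x - ws_star)))"
      by (simp add: G_def matrix_vector_mult_diff_distrib scaleR_diff_right)
    then show ?thesis using B_inner[of "x - ws_star" "B *v (x - ws_star)"]
      by (simp add: inner_add_right inner_commute[of _ "x - ws_star"] power2_norm_eq_inner)
  qed

  \<comment> \<open>The two cases differ only in the origin of the monotonicity estimate, which is
    therefore a premise; strong convexity of the aggregate serves the stationarity of
    \<open>w_star\<close>.\<close>
  have converges: "converges_linearly w y ws_star (B *v lb_star)
      (max (1 - \<mu>\<^sub>w * \<nu> * (1 - \<mu>\<^sub>w * (\<delta> + \<rho> * (sigma_max B)\<^sup>2)))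
        (1 - \<mu>\<^sub>w * \<mu>\<^sub>l * (sigma_min_nz B)\<^sup>2))"
    if strong: "strongly_convex_fun \<beta> (aggregate_cost J)" and \<nu>: "0 < \<nu>"
      and mono: "\<And>x. \<nu> * (norm (x - ws_star))\<^sup>2 \<le>
        (x - ws_star) \<bullet> (network_gradient J x - network_gradient J ws_star)
          + \<rho> * (norm (B *v (x - ws_star)))\<^sup>2"
      and step: "\<mu>\<^sub>w < 1 / (\<delta> + \<rho> * (sigma_max B)\<^sup>2)" "\<mu>\<^sub>l \<le> \<nu> / (sigma_max B)\<^sup>2"
    for \<beta> \<nu>
  proof -
    have "(\<Sum>k\<in>UNIV. gradient (J k) w_star) = 0"
      unfolding w_star by (rule aggregate_cost_minimizer_stationary[where J = J, OF J_convex J_smooth strong])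
    \<comment> \<open>Paired with a consensus vector, the stacked gradient shows only the sum of its
      blocks. So it is orthogonal to the kernel of \<open>B\<close>, the solvability condition for
      the multiplier.\<close>
    then have "col (\<lambda>_. u) \<bullet> network_gradient J ws_star = 0" for u
      by (simp add: inner_eq_sum_block ws_star inner_sum_right[symmetric])
    then have "z \<bullet> gradient (network_cost J) ws_star = 0" if "B *v z = 0" for z
      using that ker by (auto simp: gradient_eq[OF gderiv_network_cost[where J = J, OF J_smooth]])
    then have "\<exists>!l. l \<in> range (\<lambda>x. B *v x) \<and> gradient (network_cost J) ws_star + B *v l = 0"
      by (rule dual_solution_unique[OF B_sym])
    then have lb: "lb_star \<in> range (\<lambda>x. B *v x) \<and> gradient (network_cost J) ws_star + B *v lb_star = 0"
      unfolding lambda_star by (rule theI')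
    then have opt: "G ws_star + B *v lb_star = 0"
      by (simp add: G_def B_ws gradient_eq[OF gderiv_network_cost[where J = J, OF J_smooth]])
    show ?thesis
    proof (rule primal_dual_linear_convergence[where G = G and B = "\<lambda>x. B *v x" and S = "(sigma_max B)\<^sup>2"])
      fix x assume "x \<in> range (\<lambda>x. B *v x)"
      then show "(sigma_min_nz B)\<^sup>2 * (norm x)\<^sup>2 \<le> (norm (B *v x))\<^sup>2"
        by (intro norm_matrix_ge_sigma_min_nz) (auto simp: B_inner)
    next
      fix x
      show "(norm (G x - G ws_star))\<^sup>2
          \<le> (\<delta> + \<rho> * (sigma_max B)\<^sup>2) * ((G x - G ws_star) \<bullet> (x - ws_star))"
        by (rule baillon_haddad[OF gderiv_G lip_G L tangent_G])
      show "\<nu> * (norm (x - ws_star))\<^sup>2 \<le> (G x - G ws_star) \<bullet> (x - ws_star)"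
        unfolding G_mono by (rule mono)
    next
      fix i :: int assume i: "0 \<le> i"
      show "w i = w (i - 1) - \<mu>\<^sub>w *\<^sub>R G (w (i - 1)) - \<mu>\<^sub>w *\<^sub>R y (i - 1)"
        using w_rec[OF i] by (simp add: gradient_eq[OF gderiv_G])
      show "y i = y (i - 1) + \<mu>\<^sub>l *\<^sub>R (B *v (B *v w i))"
        using y_rec[OF i] by (simp add: matrix_vector_mul_assoc)
    qed (rule matrix_vector_mul_linear B_inner norm_matrix_le_sigma_max sigma_max sigma_min L \<nu>
        mu_w mu_lambda step opt lb[THEN conjunct1] B_ws y_init)+
  qed

  show ?thesis unfolding Let_def
  proof (intro conjI allI impI)
    fix \<beta> \<eta> :: real
    assume \<rho>: "0 < \<rho>" and strong: "strongly_convex_fun \<beta> (aggregate_cost J)"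
      and \<eta>: "0 < \<eta>" "\<eta> < \<beta> / (2 * \<delta>)"
    let ?\<nu> = "min (\<beta> - 2 * \<delta> * \<eta>) (\<rho> * (sigma_min_nz B)\<^sup>2 * \<eta>\<^sup>2 / (4 * (\<eta>\<^sup>2 + 1)))"
    have "0 < \<beta> - 2 * \<delta> * \<eta>" using \<eta>(2) \<delta> by (simp add: field_simps)
    moreover have "0 < 4 * (\<eta>\<^sup>2 + 1)" by (simp add: add_nonneg_pos)
    then have "0 < \<rho> * (sigma_min_nz B)\<^sup>2 * \<eta>\<^sup>2 / (4 * (\<eta>\<^sup>2 + 1))"
      using \<rho> sigma_min \<eta>(1) by (intro divide_pos_pos mult_pos_pos) auto
    ultimately show \<nu>: "0 < ?\<nu>" by simp
    assume step: "\<mu>\<^sub>w < 1 / (\<delta> + \<rho> * (sigma_max B)\<^sup>2)" "\<mu>\<^sub>l \<le> ?\<nu> / (sigma_max B)\<^sup>2"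
    show "converges_linearly w y ws_star (B *v lb_star)
      (max (1 - \<mu>\<^sub>w * ?\<nu> * (1 - \<mu>\<^sub>w * (\<delta> + \<rho> * (sigma_max B)\<^sup>2)))
        (1 - \<mu>\<^sub>w * \<mu>\<^sub>l * (sigma_min_nz B)\<^sup>2))"
      \<comment> \<open>The placeholder \<open>_\<close> leaves the monotonicity premise of
        \<open>converges\<close> as the remaining goal.\<close>
      using strong \<nu> _ step unfolding ws_star
    proof (rule converges[unfolded ws_star])
      fix x
      show "?\<nu> * (norm (x - col (\<lambda>k. w_star)))\<^sup>2 \<le>
        (x - col (\<lambda>k. w_star)) \<bullet> (network_gradient J x - network_gradient J (col (\<lambda>k. w_star)))
          + \<rho> * (norm (B *v (x - col (\<lambda>k. w_star))))\<^sup>2"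
        by (rule augmented_gradient_restricted_monotone[where J = J, OF J_convex J_smooth strong ker rho \<eta>(1)]) auto
    qed
  next
    fix \<beta> :: "'k \<Rightarrow> real"
    assume \<rho>: "\<rho> = 0" and strong: "\<forall>k. strongly_convex_fun (\<beta> k) (J k)"
      and step: "\<mu>\<^sub>w < 1 / \<delta>" "\<mu>\<^sub>l \<le> Min (range \<beta>) / (sigma_max B)\<^sup>2"
    \<comment> \<open>Supplies both the aggregate hypothesis of \<open>converges\<close> and the
      positivity of \<open>Min (range \<beta>)\<close>.\<close>
    have agg: "strongly_convex_fun (Min (range \<beta>)) (aggregate_cost J)"
      by (rule strongly_convex_aggregate_cost[where J = J, OF J_smooth]) (use strong in blast)
    show "converges_linearly w y ws_star (B *v lb_star)
      (max (1 - \<mu>\<^sub>w * Min (range \<beta>) * (1 - \<mu>\<^sub>w * \<delta>)) (1 - \<mu>\<^sub>w * \<mu>\<^sub>l * (sigma_min_nz B)\<^sup>2))"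
      using converges[OF agg, of "Min (range \<beta>)"] agg step
        network_gradient_strongly_monotone[of \<beta> J _ ws_star] strong
      by (simp add: \<rho> strongly_convex_fun_def)
  qed
qed

end
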